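(* Let $S$ be a locally finite connected graded algebra and $f\in S_d$ a regular normal element with $d\geq1$. Then the category $\operatorname{NMF}^{\mathbb Z}_S(f)$ of noncommutative graded right matrix factorizations of $f$ over $S$ is equivalent to the category $\operatorname{TMF}^{\mathbb Z}_S(f)$ of twisted graded right matrix factorizations of $f$ over $S$.
   Context: $k$ is a fixed field; a graded algebra is an $\mathbb N$-graded $k$-algebra; connected graded means $S_0=k$; locally finite means $\dim_kS_i<\infty$ for all $i$. Graded right modules have degree-preserving homomorphisms; $M(n)_i=M_{n+i}$. An element $f$ is regular if $af=0$ or $fa=0$ implies $a=0$, and normal if $Sf=fS$. For a homogeneous regular normal $f$, the normalizing automorphism $\nu$ is the unique graded automorphism of $S$ with $af=f\nu(a)$ for all $a\in S$. A noncommutative graded right matrix factorization of $f\in S_d$ over $S$ is a sequence $\{\phi^i:F^{i+1}\to F^i\}_{i\in\mathbb Z}$ of graded right $S$-module homomorphisms, where for some $r\in\mathbb N$ all $F^i$ are graded free right $S$-modules of rank $r$, such that for every $i$ there are isomorphisms $F^{i+2}\cong\bigoplus_{s=1}^rS(-m_{i+2,s})=\bigoplus_{s=1}^rS(-m_{is}-d)$ and $F^i\cong\bigoplus_{s=1}^rS(-m_{is})$ under which $\phi^i\phi^{i+1}$ corresponds to left multiplication by $f$. A morphism $\{\phi^i:F^{i+1}\to F^i\}\to\{\psi^i:G^{i+1}\to G^i\}$ is a sequence of graded homomorphisms $\mu^i:F^i\to G^i$ with $\mu^i\phi^i=\psi^i\mu^{i+1}$ for all $i$. The category is $\operatorname{NMF}^{\mathbb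 Z}_S(f)$. By convention one works with the equivalent full subcategory of objects with $F^i=\bigoplus_sS(-m_{is})$, $m_{i+2,s}=m_{is}+d$, and $\phi^i\phi^{i+1}=f\cdot$ exactly. For a graded automorphism $\sigma$ and a graded right $S$-module $M$, $M_\sigma$ is $M$ as a graded vector space with action $m*a=m\sigma(a)$. Set $M_{\mathrm{tw}}=M_{\nu^{-1}}(-d)$; a homomorphism $\phi:M\to N$ induces $\phi_{\mathrm{tw}}:M_{\mathrm{tw}}\to N_{\mathrm{tw}}$, the same underlying map. A twisted graded right matrix factorization of $f$ over $S$ is an ordered pair of graded right $S$-module homomorphisms $(\psi:F\to G,\ \tau:G_{\mathrm{tw}}\to F)$, where $F,G$ are graded free right $S$-modules of the same finite rank $r$, such that $\psi\tau=\cdot f$ (i.e. $G_{\mathrm{tw}}\to G$, $x\mapsto xf$) and $\tau\psi_{\mathrm{tw}}=\cdot f$ (i.e. $F_{\mathrm{tw}}\to F$, $x\mapsto xf$). A morphism $(\psi,\tau)\to(\psi',\tau')$ is a pair $(\mu_G:G\to G',\mu_F:F\to F')$ of graded homomorphisms with $\mu_G\psi=\psi'\mu_F$. This category is $\operatorname{TMF}^{\mathbb Z}_S(f)$. *)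

theory Defs
  imports Complex_Main "HOL-Algebra.FiniteProduct"
begin

section \<open>Categories and equivalence of categories\<close>

text \<open>Arrows do not carry their endpoints, so hom-sets need not be disjoint and composition
  takes the three objects as arguments: for g in Hom A B and h in Hom B E, the composite
  of h after g is \<open>Comp C A B E h g\<close>.\<close>

record ('o, 'h) cat =
  Obj :: "'o set"
  Hom :: "'o \<Rightarrow> 'o \<Rightarrow> 'h set"
  Ident :: "'o \<Rightarrow> 'h"
  Comp :: "'o \<Rightarrow> 'o \<Rightarrow> 'o \<Rightarrow> 'h \<Rightarrow> 'h \<Rightarrow> 'h"

definition is_category :: "('o, 'h) cat \<Rightarrow> bool" where
  "is_category C \<longleftrightarrow>
     (\<forall>A\<in>Obj C. Ident C A \<in> Hom C A A) \<and>
     (\<forall>A\<in>Obj C. \<forall>B\<in>Obj C. \<forall>E\<in>Obj C. \<forall>g\<in>Hom C A B. \<forall>h\<in>Hom C B E.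
        Comp C A B E h g \<in> Hom C A E) \<and>
     (\<forall>A\<in>Obj C. \<forall>B\<in>Obj C. \<forall>g\<in>Hom C A B.
        Comp C A A B g (Ident C A) = g \<and> Comp C A B B (Ident C B) g = g) \<and>
     (\<forall>A\<in>Obj C. \<forall>B\<in>Obj C. \<forall>D\<in>Obj C. \<forall>E\<in>Obj C.
        \<forall>g\<in>Hom C A B. \<forall>h\<in>Hom C B D. \<forall>l\<in>Hom C D E.
        Comp C A D E l (Comp C A B D h g) = Comp C A B E (Comp C B D E l h) g)"

text \<open>A functor is given by its action Fo on objects and its action Fm A B on Hom A B.\<close>

definition is_functor ::
  "('o, 'h) cat \<Rightarrow> ('p, 'l) cat \<Rightarrow> ('o \<Rightarrow> 'p) \<Rightarrow> ('o \<Rightarrow> 'o \<Rightarrow> 'h \<Rightarrow> 'l) \<Rightarrow> bool" where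
  "is_functor C D Fo Fm \<longleftrightarrow>
     (\<forall>A\<in>Obj C. Fo A \<in> Obj D) \<and>
     (\<forall>A\<in>Obj C. \<forall>B\<in>Obj C. \<forall>g\<in>Hom C A B. Fm A B g \<in> Hom D (Fo A) (Fo B)) \<and>
     (\<forall>A\<in>Obj C. Fm A A (Ident C A) = Ident D (Fo A)) \<and>
     (\<forall>A\<in>Obj C. \<forall>B\<in>Obj C. \<forall>E\<in>Obj C. \<forall>g\<in>Hom C A B. \<forall>h\<in>Hom C B E.
        Fm A E (Comp C A B E h g) = Comp D (Fo A) (Fo B) (Fo E) (Fm B E h) (Fm A B g))"

definition is_iso :: "('o, 'h) cat \<Rightarrow> 'o \<Rightarrow> 'o \<Rightarrow> 'h \<Rightarrow> bool" where
  "is_iso C A B g \<longleftrightarrow> g \<in> Hom C A B \<and>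
     (\<exists>h\<in>Hom C B A. Comp C A B A h g = Ident C A \<and> Comp C B A B g h = Ident C B)"

definition is_nat_iso ::
  "('o, 'h) cat \<Rightarrow> ('p, 'l) cat \<Rightarrow> ('o \<Rightarrow> 'p) \<Rightarrow> ('o \<Rightarrow> 'o \<Rightarrow> 'h \<Rightarrow> 'l) \<Rightarrow>
   ('o \<Rightarrow> 'p) \<Rightarrow> ('o \<Rightarrow> 'o \<Rightarrow> 'h \<Rightarrow> 'l) \<Rightarrow> ('o \<Rightarrow> 'l) \<Rightarrow> bool" where
  "is_nat_iso C D Fo Fm Go Gm \<eta> \<longleftrightarrow>
     (\<forall>A\<in>Obj C. is_iso D (Fo A) (Go A) (\<eta> A)) \<and>
     (\<forall>A\<in>Obj C. \<forall>B\<in>Obj C. \<forall>g\<in>Hom C A B.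
        Comp D (Fo A) (Fo B) (Go B) (\<eta> B) (Fm A B g) =
        Comp D (Fo A) (Go A) (Go B) (Gm A B g) (\<eta> A))"

definition equivalent_categories :: "('o, 'h) cat \<Rightarrow> ('p, 'l) cat \<Rightarrow> bool" where
  "equivalent_categories C D \<longleftrightarrow> is_category C \<and> is_category D \<and>
     (\<exists>Fo Fm Go Gm \<eta> \<epsilon>.
        is_functor C D Fo Fm \<and> is_functor D C Go Gm \<and>
        is_nat_iso C C (\<lambda>A. A) (\<lambda>A B g. g)
          (\<lambda>A. Go (Fo A)) (\<lambda>A B g. Gm (Fo A) (Fo B) (Fm A B g)) \<eta> \<and>
        is_nat_iso D D (\<lambda>A. Fo (Go A)) (\<lambda>A B g. Fm (Go A) (Go B) (Gm A B g))
          (\<lambda>A. A) (\<lambda>A B g. g) \<epsilon>)"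


section \<open>Graded algebras\<close>

text \<open>The algebra is the whole type \<open>'a\<close>; \<open>scale\<close> is the action of the field, and \<open>S i\<close> is the
  homogeneous component of degree i.\<close>

definition graded_algebra :: "('k::field \<Rightarrow> 'a::ring_1 \<Rightarrow> 'a) \<Rightarrow> (nat \<Rightarrow> 'a set) \<Rightarrow> bool" where
  "graded_algebra scale S \<longleftrightarrow>
     vector_space scale \<and>
     (\<forall>c a b. scale c (a * b) = scale c a * b \<and> scale c (a * b) = a * scale c b) \<and>
     (\<forall>i. module.subspace scale (S i)) \<and>
     (\<forall>a. \<exists>!c. (\<forall>i. c i \<in> S i) \<and> finite {i. c i \<noteq> 0} \<and> a = (\<Sum>i | c i \<noteq> 0. c i)) \<and>
     1 \<in> S 0 \<and>
     (\<forall>i j. \<forall>a\<in>S i. \<forall>b\<in>S j. a * b \<in> S (i + j))"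

definition connected_graded_algebra ::
  "('k::field \<Rightarrow> 'a::ring_1 \<Rightarrow> 'a) \<Rightarrow> (nat \<Rightarrow> 'a set) \<Rightarrow> bool" where
  "connected_graded_algebra scale S \<longleftrightarrow> graded_algebra scale S \<and> S 0 = range (\<lambda>c. scale c 1)"

definition locally_finite_algebra ::
  "('k::field \<Rightarrow> 'a::ring_1 \<Rightarrow> 'a) \<Rightarrow> (nat \<Rightarrow> 'a set) \<Rightarrow> bool" where
  "locally_finite_algebra scale S \<longleftrightarrow> (\<forall>i. \<exists>B. finite B \<and> S i \<subseteq> module.span scale B)"

definition regular_element :: "'a::ring_1 \<Rightarrow> bool" where
  "regular_element f \<longleftrightarrow> (\<forall>a. a * f = 0 \<or> f * a = 0 \<longrightarrow> a = 0)"

definition normal_element :: "'a::ring_1 \<Rightarrow> bool" where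
  "normal_element f \<longleftrightarrow> range (\<lambda>a. a * f) = range (\<lambda>a. f * a)"

definition graded_automorphism ::
  "('k::field \<Rightarrow> 'a::ring_1 \<Rightarrow> 'a) \<Rightarrow> (nat \<Rightarrow> 'a set) \<Rightarrow> ('a \<Rightarrow> 'a) \<Rightarrow> bool" where
  "graded_automorphism scale S \<sigma> \<longleftrightarrow>
     bij \<sigma> \<and> Vector_Spaces.linear scale scale \<sigma> \<and>
     \<sigma> 1 = 1 \<and> (\<forall>a b. \<sigma> (a * b) = \<sigma> a * \<sigma> b) \<and> (\<forall>i. \<sigma> ` S i = S i)"

definition normalizing_aut ::
  "('k::field \<Rightarrow> 'a::ring_1 \<Rightarrow> 'a) \<Rightarrow> (nat \<Rightarrow> 'a set) \<Rightarrow> 'a \<Rightarrow> ('a \<Rightarrow> 'a)" where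
  "normalizing_aut scale S f =
     (THE \<nu>. graded_automorphism scale S \<nu> \<and> (\<forall>a. a * f = f * \<nu> a))"


section \<open>Graded right modules\<close>

text \<open>Modules over an algebra of type \<open>'a\<close> have a carrier inside a type \<open>'m\<close>, which plays the
  role of the universe. The action \<open>act M x a\<close> is the right action of a on x. The grading is
  indexed by the integers. The vector space structure of a module is the one induced by the
  action of the scalar multiples of 1.\<close>

record ('a, 'm) rmod = "'m partial_object" +
  madd :: "'m \<Rightarrow> 'm \<Rightarrow> 'm"
  mzero :: 'm
  act :: "'m \<Rightarrow> 'a \<Rightarrow> 'm"
  grade :: "int \<Rightarrow> 'm set"

definition add_group :: "('a, 'm) rmod \<Rightarrow> 'm monoid" where
  "add_group M = \<lparr>carrier = carrier M, mult = madd M, one = mzero M\<rparr>"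

definition graded_right_module :: "(nat \<Rightarrow> 'a::ring_1 set) \<Rightarrow> ('a, 'm) rmod \<Rightarrow> bool" where
  "graded_right_module S M \<longleftrightarrow>
     comm_group (add_group M) \<and>
     (\<forall>x\<in>carrier M. \<forall>a. act M x a \<in> carrier M) \<and>
     (\<forall>x\<in>carrier M. \<forall>y\<in>carrier M. \<forall>a. act M (madd M x y) a = madd M (act M x a) (act M y a)) \<and>
     (\<forall>x\<in>carrier M. \<forall>a b. act M x (a + b) = madd M (act M x a) (act M x b)) \<and>
     (\<forall>x\<in>carrier M. \<forall>a b. act M x (a * b) = act M (act M x a) b) \<and>
     (\<forall>x\<in>carrier M. act M x 1 = x) \<and>
     (\<forall>i. subgroup (grade M i) (add_group M)) \<and>
     (\<forall>x\<in>carrier M. \<exists>!c. (\<forall>i. c i \<in> grade M i) \<and> finite {i. c i \<noteq> mzero M} \<and>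
        x = finprod (add_group M) c {i. c i \<noteq> mzero M}) \<and>
     (\<forall>i j. \<forall>x\<in>grade M i. \<forall>a\<in>S j. act M x a \<in> grade M (i + int j))"

text \<open>Homomorphisms are extensional, so that two of them are equal as soon as they agree on
  the carrier of their domain.\<close>

definition gr_hom :: "('a::ring_1, 'm) rmod \<Rightarrow> ('a, 'n) rmod \<Rightarrow> ('m \<Rightarrow> 'n) set" where
  "gr_hom M N = {h \<in> carrier M \<rightarrow>\<^sub>E carrier N.
     (\<forall>x\<in>carrier M. \<forall>y\<in>carrier M. h (madd M x y) = madd N (h x) (h y)) \<and>
     (\<forall>x\<in>carrier M. \<forall>a. h (act M x a) = act N (h x) a) \<and>
     (\<forall>i. h ` grade M i \<subseteq> grade N i)}"

definition gr_iso :: "('a::ring_1, 'm) rmod \<Rightarrow> ('a, 'n) rmod \<Rightarrow> ('m \<Rightarrow> 'n) set" where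
  "gr_iso M N = {h \<in> gr_hom M N. \<exists>g\<in>gr_hom N M.
     (\<forall>x\<in>carrier M. g (h x) = x) \<and> (\<forall>y\<in>carrier N. h (g y) = y)}"

definition shift :: "int \<Rightarrow> ('a, 'm) rmod \<Rightarrow> ('a, 'm) rmod" where
  "shift n M = M\<lparr>grade := \<lambda>i. grade M (n + i)\<rparr>"

definition twist :: "('a \<Rightarrow> 'a) \<Rightarrow> ('a, 'm) rmod \<Rightarrow> ('a, 'm) rmod" where
  "twist \<sigma> M = M\<lparr>act := \<lambda>x a. act M x (\<sigma> a)\<rparr>"

definition self_module :: "(nat \<Rightarrow> 'a::ring_1 set) \<Rightarrow> ('a, 'a) rmod" where
  "self_module S = \<lparr>carrier = UNIV, madd = (+), mzero = 0, act = (*),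
     grade = (\<lambda>i. if i < 0 then {0} else S (nat i))\<rparr>"

definition direct_sum :: "nat \<Rightarrow> (nat \<Rightarrow> ('a, 'm) rmod) \<Rightarrow> ('a, nat \<Rightarrow> 'm) rmod" where
  "direct_sum r M = \<lparr>carrier = (\<Pi>\<^sub>E s\<in>{..<r}. carrier (M s)),
     madd = (\<lambda>x y. \<lambda>s\<in>{..<r}. madd (M s) (x s) (y s)),
     mzero = (\<lambda>s\<in>{..<r}. mzero (M s)),
     act = (\<lambda>x a. \<lambda>s\<in>{..<r}. act (M s) (x s) a),
     grade = (\<lambda>i. \<Pi>\<^sub>E s\<in>{..<r}. grade (M s) i)\<rparr>"

text \<open>The direct sum of the S(-m s) for s < r.\<close>

definition free_module ::
  "(nat \<Rightarrow> 'a::ring_1 set) \<Rightarrow> nat \<Rightarrow> (nat \<Rightarrow> int) \<Rightarrow> ('a, nat \<Rightarrow> 'a) rmod" where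
  "free_module S r m = direct_sum r (\<lambda>s. shift (- m s) (self_module S))"

definition graded_free :: "(nat \<Rightarrow> 'a::ring_1 set) \<Rightarrow> nat \<Rightarrow> ('a, 'm) rmod \<Rightarrow> bool" where
  "graded_free S r M \<longleftrightarrow> graded_right_module S M \<and> (\<exists>m. gr_iso M (free_module S r m) \<noteq> {})"

definition left_mult :: "nat \<Rightarrow> 'a::ring_1 \<Rightarrow> (nat \<Rightarrow> 'a) \<Rightarrow> (nat \<Rightarrow> 'a)" where
  "left_mult r f x = (\<lambda>s\<in>{..<r}. f * x s)"

definition tw :: "('k::field \<Rightarrow> 'a::ring_1 \<Rightarrow> 'a) \<Rightarrow> (nat \<Rightarrow> 'a set) \<Rightarrow> 'a \<Rightarrow> nat \<Rightarrow>
    ('a, 'm) rmod \<Rightarrow> ('a, 'm) rmod" where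
  "tw scale S f d M = shift (- int d) (twist (inv_into UNIV (normalizing_aut scale S f)) M)"


section \<open>Noncommutative graded right matrix factorizations\<close>

record ('a, 'm) nmf =
  nmod :: "int \<Rightarrow> ('a, 'm) rmod"
  nmap :: "int \<Rightarrow> 'm \<Rightarrow> 'm"

definition is_nmf ::
  "(nat \<Rightarrow> 'a::ring_1 set) \<Rightarrow> 'a \<Rightarrow> nat \<Rightarrow> ('a, 'm) nmf \<Rightarrow> bool" where
  "is_nmf S f d X \<longleftrightarrow>
     (\<forall>i. nmap X i \<in> gr_hom (nmod X (i + 1)) (nmod X i)) \<and>
     (\<exists>r. (\<forall>i. graded_free S r (nmod X i)) \<and>
        (\<exists>m :: int \<Rightarrow> nat \<Rightarrow> int. \<forall>i.
           (\<forall>s<r. m (i + 2) s = m i s + int d) \<and>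
           (\<exists>\<alpha>\<in>gr_iso (nmod X (i + 2)) (free_module S r (m (i + 2))).
            \<exists>\<beta>\<in>gr_iso (nmod X i) (free_module S r (m i)).
              \<forall>x\<in>carrier (nmod X (i + 2)).
                \<beta> (nmap X i (nmap X (i + 1) x)) = left_mult r f (\<alpha> x))))"

definition nmf_hom :: "('a::ring_1, 'm) nmf \<Rightarrow> ('a, 'm) nmf \<Rightarrow> (int \<Rightarrow> 'm \<Rightarrow> 'm) set" where
  "nmf_hom X Y = {\<mu>. \<forall>i. \<mu> i \<in> gr_hom (nmod X i) (nmod Y i) \<and>
     (\<forall>x\<in>carrier (nmod X (i + 1)). \<mu> i (nmap X i x) = nmap Y i (\<mu> (i + 1) x))}"

definition NMF ::
  "(nat \<Rightarrow> 'a::ring_1 set) \<Rightarrow> 'a \<Rightarrow> nat \<Rightarrow> (('a, 'm) nmf, int \<Rightarrow> 'm \<Rightarrow> 'm) cat" where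
  "NMF S f d = \<lparr>Obj = {X. is_nmf S f d X}, Hom = nmf_hom,
     Ident = (\<lambda>X i. \<lambda>x\<in>carrier (nmod X i). x),
     Comp = (\<lambda>X Y Z \<mu> \<kappa> i. compose (carrier (nmod X i)) (\<mu> i) (\<kappa> i))\<rparr>"


section \<open>Twisted graded right matrix factorizations\<close>

record ('a, 'm) tmf =
  tF :: "('a, 'm) rmod"
  tG :: "('a, 'm) rmod"
  tpsi :: "'m \<Rightarrow> 'm"
  ttau :: "'m \<Rightarrow> 'm"

text \<open>The twisted module has the same carrier as the original one, and the twist of a
  homomorphism is the same underlying map; hence \<open>tpsi X\<close> also stands for its own twist.\<close>

definition is_tmf :: "('k::field \<Rightarrow> 'a::ring_1 \<Rightarrow> 'a) \<Rightarrow> (nat \<Rightarrow> 'a set) \<Rightarrow> 'a \<Rightarrow> nat \<Rightarrow>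
    ('a, 'm) tmf \<Rightarrow> bool" where
  "is_tmf scale S f d X \<longleftrightarrow>
     (\<exists>r. graded_free S r (tF X) \<and> graded_free S r (tG X)) \<and>
     tpsi X \<in> gr_hom (tF X) (tG X) \<and>
     ttau X \<in> gr_hom (tw scale S f d (tG X)) (tF X) \<and>
     (\<forall>x\<in>carrier (tG X). tpsi X (ttau X x) = act (tG X) x f) \<and>
     (\<forall>x\<in>carrier (tF X). ttau X (tpsi X x) = act (tF X) x f)"

text \<open>A morphism is a pair of a map between the \<open>tG\<close> and a map between the \<open>tF\<close>, in this order.\<close>

definition tmf_hom :: "('a::ring_1, 'm) tmf \<Rightarrow> ('a, 'm) tmf \<Rightarrow> (('m \<Rightarrow> 'm) \<times> ('m \<Rightarrow> 'm)) set" where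
  "tmf_hom X Y = {(\<mu>G, \<mu>F). \<mu>G \<in> gr_hom (tG X) (tG Y) \<and> \<mu>F \<in> gr_hom (tF X) (tF Y) \<and>
     (\<forall>x\<in>carrier (tF X). \<mu>G (tpsi X x) = tpsi Y (\<mu>F x))}"

definition TMF :: "('k::field \<Rightarrow> 'a::ring_1 \<Rightarrow> 'a) \<Rightarrow> (nat \<Rightarrow> 'a set) \<Rightarrow> 'a \<Rightarrow> nat \<Rightarrow>
    (('a, 'm) tmf, ('m \<Rightarrow> 'm) \<times> ('m \<Rightarrow> 'm)) cat" where
  "TMF scale S f d = \<lparr>Obj = {X. is_tmf scale S f d X}, Hom = tmf_hom,
     Ident = (\<lambda>X. (\<lambda>x\<in>carrier (tG X). x, \<lambda>x\<in>carrier (tF X). x)),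
     Comp = (\<lambda>X Y Z \<mu> \<kappa>. (compose (carrier (tG X)) (fst \<mu>) (fst \<kappa>),
                           compose (carrier (tF X)) (snd \<mu>) (snd \<kappa>)))\<rparr>"

end

theory Submission
  imports Defs
begin

text \<open>
  Unrolling a twisted factorization \<open>(\<psi>: F \<rightarrow> G, \<tau>: G\<^sub>t\<^sub>w \<rightarrow> F)\<close> to the sequence of the iterated twists
  \<open>\<dots> \<rightarrow> G\<^sub>t\<^sub>w \<rightarrow> F \<rightarrow> G \<rightarrow> \<dots>\<close> is a functor to NMF. It is fully faithful: a morphism between unrolled
  factorizations commutes with right multiplication by f, which is injective on free modules, so it
  is 2-periodic; by the same injectivity, compatibility with \<open>\<psi>\<close> forces compatibility with \<open>\<tau>\<close>.
  It is essentially surjective: in any factorization \<open>\<phi>\<close> in NMF, the condition on \<open>\<phi>\<^sup>i \<phi>\<^sup>i\<^sup>+\<^sup>1\<close> says that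
  there is a unique isomorphism \<open>\<theta>\<close> from the module in position i+2 to the twist of the module in
  position i with \<open>\<theta>(x) f = \<phi>\<^sup>i \<phi>\<^sup>i\<^sup>+\<^sup>1 x\<close>; these are natural in i, and composing them
  identifies the sequence with the unrolling of its positions 0, 1.
\<close>

section \<open>Fully faithful and essentially surjective functors\<close>

text \<open>The given functor goes from D to C and its quasi-inverse is chosen: for every X an
  object \<open>Fo X\<close> with an isomorphism \<open>\<eta> X\<close> from X to
  \<open>Go (Fo X)\<close>. A morphism is transported along \<open>\<eta>\<close> and then lifted
  through the bijection of hom-sets. Equations in D are checked after applying \<open>Gm\<close>,
  which is injective on each hom-set.\<close>

lemma equivalent_categories_if_fully_faithful_ess_surj:
  assumes C: "is_category C" and D: "is_category D" and G: "is_functor D C Go Gm"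
    and ff: "\<And>A B. A \<in> Obj D \<Longrightarrow> B \<in> Obj D \<Longrightarrow> bij_betw (Gm A B) (Hom D A B) (Hom C (Go A) (Go B))"
    and es: "\<And>X. X \<in> Obj C \<Longrightarrow> \<exists>A\<in>Obj D. \<exists>g. is_iso C X (Go A) g"
  shows "equivalent_categories C D"
proof -
  have "\<forall>X\<in>Obj C. \<exists>A. A \<in> Obj D \<and> (\<exists>g. is_iso C X (Go A) g)"
    using es by blast
  from bchoice[OF this] obtain Fo where Fo: "\<And>X. X \<in> Obj C \<Longrightarrow> Fo X \<in> Obj D"
    and "\<forall>X\<in>Obj C. \<exists>g. is_iso C X (Go (Fo X)) g" by blast
  from bchoice[OF this(2)] obtain \<eta>
    where \<eta>: "\<And>X. X \<in> Obj C \<Longrightarrow> is_iso C X (Go (Fo X)) (\<eta> X)" by blast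
  have "\<forall>X\<in>Obj C. \<exists>h. h \<in> Hom C (Go (Fo X)) X \<and>
      Comp C X (Go (Fo X)) X h (\<eta> X) = Ident C X \<and>
      Comp C (Go (Fo X)) X (Go (Fo X)) (\<eta> X) h = Ident C (Go (Fo X))"
    using \<eta> unfolding is_iso_def by blast
  from bchoice[OF this] obtain inv\<eta> where inv: "\<And>X. X \<in> Obj C \<Longrightarrow> inv\<eta> X \<in> Hom C (Go (Fo X)) X \<and>
      Comp C X (Go (Fo X)) X (inv\<eta> X) (\<eta> X) = Ident C X \<and>
      Comp C (Go (Fo X)) X (Go (Fo X)) (\<eta> X) (inv\<eta> X) = Ident C (Go (Fo X))"
    by blast
  have \<eta>H: "\<eta> X \<in> Hom C X (Go (Fo X))" if "X \<in> Obj C" for X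
    using \<eta>[OF that] by (simp add: is_iso_def)
  define Gi where "Gi A B = inv_into (Hom D A B) (Gm A B)" for A B
  have Go: "Go A \<in> Obj C" if "A \<in> Obj D" for A using G that unfolding is_functor_def by blast
  have Gm: "Gm A B g \<in> Hom C (Go A) (Go B)" if "A \<in> Obj D" "B \<in> Obj D" "g \<in> Hom D A B" for A B g
    using G that unfolding is_functor_def by blast
  have Gid: "Gm A A (Ident D A) = Ident C (Go A)" if "A \<in> Obj D" for A
    using G that unfolding is_functor_def by blast
  have Gcomp: "Gm A E (Comp D A B E h g) = Comp C (Go A) (Go B) (Go E) (Gm B E h) (Gm A B g)"
    if "A \<in> Obj D" "B \<in> Obj D" "E \<in> Obj D" "g \<in> Hom D A B" "h \<in> Hom D B E" for A B E g h
    using G that unfolding is_functor_def by blast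
  have GiH: "Gi A B g \<in> Hom D A B" and GGi: "Gm A B (Gi A B g) = g"
    if "A \<in> Obj D" "B \<in> Obj D" "g \<in> Hom C (Go A) (Go B)" for A B g
    using ff[OF that(1,2)] that(3) unfolding Gi_def
    by (auto simp: bij_betw_def inv_into_into f_inv_into_f)
  have inj: "g = h" if "Gm A B g = Gm A B h" "A \<in> Obj D" "B \<in> Obj D" "g \<in> Hom D A B" "h \<in> Hom D A B"
    for A B g h using ff[OF that(2,3)] that by (auto simp: bij_betw_def inj_on_def)
  have Cid: "Ident C A \<in> Hom C A A" if "A \<in> Obj C" for A
    using C that unfolding is_category_def by blast+
  have Cc: "Comp C A B E h g \<in> Hom C A E"
    if "A \<in> Obj C" "B \<in> Obj C" "E \<in> Obj C" "g \<in> Hom C A B" "h \<in> Hom C B E" for A B E g h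
    using C that unfolding is_category_def by blast+
  have Cl: "Comp C A A B g (Ident C A) = g" and Cr: "Comp C A B B (Ident C B) g = g"
    if "A \<in> Obj C" "B \<in> Obj C" "g \<in> Hom C A B" for A B g
    using C that unfolding is_category_def by blast+
  have Ca: "Comp C A B' E l (Comp C A B B' h g) = Comp C A B E (Comp C B B' E l h) g"
    if "A \<in> Obj C" "B \<in> Obj C" "B' \<in> Obj C" "E \<in> Obj C" "g \<in> Hom C A B" "h \<in> Hom C B B'" "l \<in> Hom C B' E"
    for A B B' E g h l
    using C that unfolding is_category_def by blast+
  have Did: "Ident D A \<in> Hom D A A" if "A \<in> Obj D" for A
    using D that unfolding is_category_def by blast+
  have Dc: "Comp D A B E h g \<in> Hom D A E"
    if "A \<in> Obj D" "B \<in> Obj D" "E \<in> Obj D" "g \<in> Hom D A B" "h \<in> Hom D B E" for A B E g h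
    using D that unfolding is_category_def by blast+
  \<comment> \<open>The conjugate of g by the chosen isomorphisms: first \<open>inv\<eta> X\<close>,
    then g, then \<open>\<eta> Y\<close>.\<close>
  define Lm where "Lm X Y g = Comp C (Go (Fo X)) Y (Go (Fo Y)) (\<eta> Y) (Comp C (Go (Fo X)) X Y g (inv\<eta> X))"
    for X Y g
  have LmH: "Lm X Y g \<in> Hom C (Go (Fo X)) (Go (Fo Y))"
    if "X \<in> Obj C" "Y \<in> Obj C" "g \<in> Hom C X Y" for X Y g
    unfolding Lm_def using that by (intro Cc) (auto simp: Fo Go \<eta>H inv)
  have Lm\<eta>: "Comp C X (Go (Fo X)) (Go (Fo Y)) (Lm X Y g) (\<eta> X) = Comp C X Y (Go (Fo Y)) (\<eta> Y) g"
    if "X \<in> Obj C" "Y \<in> Obj C" "g \<in> Hom C X Y" for X Y g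
    unfolding Lm_def using that
    by (simp add: Ca[symmetric] Fo Go \<eta>H inv Cc Cl)
  \<comment> \<open>\<open>\<eta> X\<close> has a right inverse and is therefore epi, so morphisms
    out of \<open>Go (Fo X)\<close> can be compared after composition with it.\<close>
  have uniq: "u = v" if "X \<in> Obj C" "Y \<in> Obj C" "u \<in> Hom C (Go (Fo X)) Y" "v \<in> Hom C (Go (Fo X)) Y"
    "Comp C X (Go (Fo X)) Y u (\<eta> X) = Comp C X (Go (Fo X)) Y v (\<eta> X)" for X Y u v
  proof -
    have "w = Comp C (Go (Fo X)) X Y (Comp C X (Go (Fo X)) Y w (\<eta> X)) (inv\<eta> X)"
      if "w \<in> Hom C (Go (Fo X)) Y" for w
      using that \<open>X \<in> Obj C\<close> \<open>Y \<in> Obj C\<close> by (simp add: Ca[symmetric] Fo Go \<eta>H inv Cl)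
    then show ?thesis using that by metis
  qed
  define Fm where "Fm X Y g = Gi (Fo X) (Fo Y) (Lm X Y g)" for X Y g
  have FmH: "Fm X Y g \<in> Hom D (Fo X) (Fo Y)" and GFm: "Gm (Fo X) (Fo Y) (Fm X Y g) = Lm X Y g"
    if "X \<in> Obj C" "Y \<in> Obj C" "g \<in> Hom C X Y" for X Y g
    using that LmH[OF that] by (auto simp: Fm_def GiH GGi Fo)
  have F: "is_functor C D Fo Fm"
    unfolding is_functor_def
  proof (intro conjI ballI)
    fix A assume A: "A \<in> Obj C"
    show "Fm A A (Ident C A) = Ident D (Fo A)"
      using A by (intro inj[of "Fo A" "Fo A"]) (simp_all add: FmH Cid Did Fo GFm Gid Lm_def inv Cr Go)
  next
    fix A B E g h assume a: "A \<in> Obj C" "B \<in> Obj C" "E \<in> Obj C" "g \<in> Hom C A B" "h \<in> Hom C B E"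
    have "Lm A E (Comp C A B E h g) = Comp C (Go (Fo A)) (Go (Fo B)) (Go (Fo E)) (Lm B E h) (Lm A B g)"
    proof (rule uniq[of A "Go (Fo E)"])
      have "Comp C A (Go (Fo A)) (Go (Fo E)) (Lm A E (Comp C A B E h g)) (\<eta> A)
          = Comp C A B (Go (Fo E)) (Comp C B E (Go (Fo E)) (\<eta> E) h) g"
        using a by (simp add: Lm\<eta> Cc Ca Fo Go \<eta>H)
      also have "\<dots> = Comp C A B (Go (Fo E)) (Comp C B (Go (Fo B)) (Go (Fo E)) (Lm B E h) (\<eta> B)) g"
        using a by (simp add: Lm\<eta>)
      also have "\<dots> = Comp C A (Go (Fo B)) (Go (Fo E)) (Lm B E h) (Comp C A (Go (Fo A)) (Go (Fo B)) (Lm A B g) (\<eta> A))"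
        using a by (simp add: Lm\<eta> Ca Fo Go \<eta>H LmH)
      also have "\<dots> = Comp C A (Go (Fo A)) (Go (Fo E)) (Comp C (Go (Fo A)) (Go (Fo B)) (Go (Fo E)) (Lm B E h) (Lm A B g)) (\<eta> A)"
        using a by (simp add: Ca Fo Go \<eta>H LmH)
      finally show "Comp C A (Go (Fo A)) (Go (Fo E)) (Lm A E (Comp C A B E h g)) (\<eta> A) = \<dots>" .
    qed (use a in \<open>auto simp: Fo Go LmH Cc\<close>)
    then show "Fm A E (Comp C A B E h g) = Comp D (Fo A) (Fo B) (Fo E) (Fm B E h) (Fm A B g)"
      using a by (intro inj[of "Fo A" "Fo E"]) (simp_all add: FmH Cc Dc Fo GFm Gcomp)
  qed (simp_all add: Fo FmH)
  \<comment> \<open>The counit at A lifts the inverse of \<open>\<eta> (Go A)\<close> through G; the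
    lift of \<open>\<eta> (Go A)\<close> itself is its inverse.\<close>
  define \<epsilon> where "\<epsilon> A = Gi (Fo (Go A)) A (inv\<eta> (Go A))" for A
  define \<epsilon>' where "\<epsilon>' A = Gi A (Fo (Go A)) (\<eta> (Go A))" for A
  have \<epsilon>H: "\<epsilon> A \<in> Hom D (Fo (Go A)) A" "Gm (Fo (Go A)) A (\<epsilon> A) = inv\<eta> (Go A)"
    and \<epsilon>'H: "\<epsilon>' A \<in> Hom D A (Fo (Go A))" "Gm A (Fo (Go A)) (\<epsilon>' A) = \<eta> (Go A)"
    if "A \<in> Obj D" for A
    using that by (auto simp: \<epsilon>_def \<epsilon>'_def intro!: GiH GGi simp: Fo Go inv \<eta>H)
  have "is_nat_iso C C (\<lambda>A. A) (\<lambda>A B g. g)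
          (\<lambda>A. Go (Fo A)) (\<lambda>A B g. Gm (Fo A) (Fo B) (Fm A B g)) \<eta>"
    by (simp add: is_nat_iso_def \<eta> GFm Lm\<eta>)
  moreover have "is_nat_iso D D (\<lambda>A. Fo (Go A)) (\<lambda>A B g. Fm (Go A) (Go B) (Gm A B g))
          (\<lambda>A. A) (\<lambda>A B g. g) \<epsilon>"
    unfolding is_nat_iso_def
  proof (intro conjI ballI)
    fix A assume A: "A \<in> Obj D"
    have "Comp D (Fo (Go A)) A (Fo (Go A)) (\<epsilon>' A) (\<epsilon> A) = Ident D (Fo (Go A))"
      using A by (intro inj[of "Fo (Go A)" "Fo (Go A)"])
        (simp_all add: Fo Go Gcomp Gid \<epsilon>H \<epsilon>'H Dc Did inv)
    moreover have "Comp D A (Fo (Go A)) A (\<epsilon> A) (\<epsilon>' A) = Ident D A"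
      using A by (intro inj[of A A]) (simp_all add: Fo Go Gcomp Gid \<epsilon>H \<epsilon>'H Dc Did inv)
    ultimately show "is_iso D (Fo (Go A)) A (\<epsilon> A)"
      using A \<epsilon>H \<epsilon>'H by (auto simp: is_iso_def)
  next
    fix A B g assume a: "A \<in> Obj D" "B \<in> Obj D" "g \<in> Hom D A B"
    have "Comp C (Go (Fo (Go A))) (Go (Fo (Go B))) (Go B) (inv\<eta> (Go B)) (Lm (Go A) (Go B) (Gm A B g))
       = Comp C (Go (Fo (Go A))) (Go A) (Go B) (Gm A B g) (inv\<eta> (Go A))"
      using a by (simp add: Lm_def Ca Fo Go \<eta>H inv Gm Cc Cr)
    then show "Comp D (Fo (Go A)) (Fo (Go B)) B (\<epsilon> B) (Fm (Go A) (Go B) (Gm A B g)) =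
        Comp D (Fo (Go A)) A B g (\<epsilon> A)"
      using a by (intro inj[of "Fo (Go A)" B]) (simp_all add: Fo Go Gcomp Gm FmH GFm \<epsilon>H Dc)
  qed
  ultimately show ?thesis
    using C D F G unfolding equivalent_categories_def by blast
qed

section \<open>Graded homomorphisms\<close>

lemma gr_homD:
  assumes "h \<in> gr_hom M N"
  shows "h \<in> extensional (carrier M)"
    and "x \<in> carrier M \<Longrightarrow> h x \<in> carrier N"
    and "x \<in> carrier M \<Longrightarrow> y \<in> carrier M \<Longrightarrow> h (madd M x y) = madd N (h x) (h y)"
    and "x \<in> carrier M \<Longrightarrow> h (act M x a) = act N (h x) a"
    and "x \<in> grade M i \<Longrightarrow> h x \<in> grade N i"
  using assms unfolding gr_hom_def PiE_iff image_subset_iff by blast+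

lemma gr_homI:
  assumes "h \<in> extensional (carrier M)"
    and "\<And>x. x \<in> carrier M \<Longrightarrow> h x \<in> carrier N"
    and "\<And>x y. x \<in> carrier M \<Longrightarrow> y \<in> carrier M \<Longrightarrow> h (madd M x y) = madd N (h x) (h y)"
    and "\<And>x a. x \<in> carrier M \<Longrightarrow> h (act M x a) = act N (h x) a"
    and "\<And>x i. x \<in> grade M i \<Longrightarrow> h x \<in> grade N i"
  shows "h \<in> gr_hom M N"
  using assms by (simp add: gr_hom_def PiE_iff image_subset_iff)

lemma gr_hom_eqI:
  assumes "g \<in> gr_hom M N" "h \<in> gr_hom M N'" "\<And>x. x \<in> carrier M \<Longrightarrow> g x = h x"
  shows "g = h"
  using assms by (blast intro: extensionalityI dest: gr_homD(1))

text \<open>The fragment of the module axioms that makes identities and composites of extensional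
  homomorphisms homomorphisms again. It can be read off directly for free modules, without verifying
  the remaining axioms.\<close>

definition closed_module :: "('a::ring_1, 'm) rmod \<Rightarrow> bool" where
  "closed_module M \<longleftrightarrow> (\<forall>x\<in>carrier M. \<forall>y\<in>carrier M. madd M x y \<in> carrier M) \<and>
     (\<forall>x\<in>carrier M. \<forall>a. act M x a \<in> carrier M) \<and> (\<forall>i. grade M i \<subseteq> carrier M)"

lemma closed_moduleD:
  assumes "closed_module M"
  shows "x \<in> carrier M \<Longrightarrow> y \<in> carrier M \<Longrightarrow> madd M x y \<in> carrier M"
    and "x \<in> carrier M \<Longrightarrow> act M x a \<in> carrier M"
    and "x \<in> grade M i \<Longrightarrow> x \<in> carrier M"
  using assms unfolding closed_module_def by blast+

lemma graded_right_module_closed: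
  assumes "graded_right_module S M"
  shows "closed_module M"
proof -
  interpret comm_group "add_group M" using assms by (simp add: graded_right_module_def)
  have "subgroup (grade M i) (add_group M)" for i using assms by (simp add: graded_right_module_def)
  then have "grade M i \<subseteq> carrier M" for i using subgroup.subset by (fastforce simp: add_group_def)
  moreover have "\<forall>x\<in>carrier M. \<forall>a. act M x a \<in> carrier M"
    using assms by (simp add: graded_right_module_def)
  ultimately show ?thesis
    using m_closed by (simp add: closed_module_def add_group_def)
qed

lemma graded_free_closed: "graded_free S r M \<Longrightarrow> closed_module M"
  unfolding graded_free_def by (blast dest: graded_right_module_closed)

lemma free_module_closed: "closed_module (free_module S r m)"
  by (auto simp: closed_module_def free_module_def direct_sum_def shift_def self_module_def PiE_iff)

lemma gr_hom_id: "closed_module M \<Longrightarrow> (\<lambda>x\<in>carrier M. x) \<in> gr_hom M M"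
  by (rule gr_homI) (auto dest: closed_moduleD)

lemma gr_hom_compose:
  assumes "closed_module M" "g \<in> gr_hom M N" "h \<in> gr_hom N P"
  shows "compose (carrier M) h g \<in> gr_hom M P"
proof (rule gr_homI)
  fix x y assume xy: "x \<in> carrier M" "y \<in> carrier M"
  show "compose (carrier M) h g (madd M x y) =
      madd P (compose (carrier M) h g x) (compose (carrier M) h g y)"
    using xy assms by (simp add: compose_eq closed_moduleD gr_homD(2,3)[OF assms(2)] gr_homD(3)[OF assms(3)])
next
  fix x a assume "x \<in> carrier M"
  then show "compose (carrier M) h g (act M x a) = act P (compose (carrier M) h g x) a"
    using assms by (simp add: compose_eq closed_moduleD gr_homD(2,4)[OF assms(2)] gr_homD(4)[OF assms(3)])
next
  fix x i assume "x \<in> grade M i"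
  then show "compose (carrier M) h g x \<in> grade P i"
    using assms by (simp add: compose_eq closed_moduleD(3) gr_homD(5)[OF assms(2)] gr_homD(5)[OF assms(3)])
qed (simp_all add: compose_eq compose_extensional gr_homD(2)[OF assms(2)] gr_homD(2)[OF assms(3)])

section \<open>Graded isomorphisms\<close>

lemma gr_isoD:
  assumes "h \<in> gr_iso M N"
  shows "h \<in> gr_hom M N" and "bij_betw h (carrier M) (carrier N)"
    and "\<exists>g\<in>gr_iso N M. (\<forall>x\<in>carrier M. g (h x) = x) \<and> (\<forall>y\<in>carrier N. h (g y) = y)"
proof -
  obtain g where g: "h \<in> gr_hom M N" "g \<in> gr_hom N M" "\<forall>x\<in>carrier M. g (h x) = x" "\<forall>y\<in>carrier N. h (g y) = y"
    using assms by (auto simp: gr_iso_def)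
  show "h \<in> gr_hom M N" by fact
  show "bij_betw h (carrier M) (carrier N)"
    using g(3,4) gr_homD(2)[OF g(1)] gr_homD(2)[OF g(2)]
    by (intro bij_betw_byWitness[where f' = g]) auto
  show "\<exists>g\<in>gr_iso N M. (\<forall>x\<in>carrier M. g (h x) = x) \<and> (\<forall>y\<in>carrier N. h (g y) = y)"
    using g by (auto simp: gr_iso_def)
qed

lemma gr_iso_id: "closed_module M \<Longrightarrow> (\<lambda>x\<in>carrier M. x) \<in> gr_iso M M"
  by (auto simp: gr_iso_def gr_hom_id intro!: bexI[of _ "\<lambda>x\<in>carrier M. x"])

lemma gr_iso_compose:
  assumes "closed_module M" "closed_module P" "g \<in> gr_iso M N" "h \<in> gr_iso N P"
  shows "compose (carrier M) h g \<in> gr_iso M P"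
proof -
  obtain g' h' where g': "g' \<in> gr_iso N M" "\<forall>x\<in>carrier M. g' (g x) = x" "\<forall>y\<in>carrier N. g (g' y) = y"
    and h': "h' \<in> gr_iso P N" "\<forall>x\<in>carrier N. h' (h x) = x" "\<forall>y\<in>carrier P. h (h' y) = y"
    using gr_isoD(3)[OF assms(3)] gr_isoD(3)[OF assms(4)] by blast
  note hom = assms(3,4)[THEN gr_isoD(1)] g'(1)[THEN gr_isoD(1)] h'(1)[THEN gr_isoD(1)]
  have "compose (carrier P) g' h' \<in> gr_hom P M" "compose (carrier M) h g \<in> gr_hom M P"
    using assms hom by (auto intro: gr_hom_compose)
  then show ?thesis
    using g'(2,3) h'(2,3) hom[THEN gr_homD(2)] unfolding gr_iso_def
    by (auto intro!: bexI[of _ "compose (carrier P) g' h'"] simp: compose_eq)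
qed

section \<open>The normalizing automorphism\<close>

locale normalized_element =
  fixes scale :: "'k::field \<Rightarrow> 'a::ring_1 \<Rightarrow> 'a" and S :: "nat \<Rightarrow> 'a set" and f :: 'a and d :: nat
  assumes graded: "graded_algebra scale S" and f_S: "f \<in> S d"
    and regular: "regular_element f" and normal: "normal_element f"
begin

abbreviation \<nu> :: "'a \<Rightarrow> 'a" where "\<nu> \<equiv> normalizing_aut scale S f"
abbreviation \<nu>' :: "'a \<Rightarrow> 'a" where "\<nu>' \<equiv> inv_into UNIV \<nu>"
abbreviation tws :: "('a, 'm) rmod \<Rightarrow> ('a, 'm) rmod" where "tws \<equiv> tw scale S f d"

lemma cancel_right: "a * f = b * f \<Longrightarrow> a = b"
  and cancel_left: "f * a = f * b \<Longrightarrow> a = b"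
  using regular[unfolded regular_element_def, rule_format, of "a - b"] by (auto simp: algebra_simps)

lemma S_subspace: "module.subspace scale (S i)"
  and S_mult: "a \<in> S i \<Longrightarrow> b \<in> S j \<Longrightarrow> a * b \<in> S (i + j)"
  and S_decomposition: "\<exists>!c. (\<forall>i. c i \<in> S i) \<and> finite {i. c i \<noteq> 0} \<and> a = (\<Sum>i | c i \<noteq> 0. c i)"
  and vs: "vector_space scale"
  and scale_mult: "scale t (a * b) = scale t a * b" "scale t (a * b) = a * scale t b"
  using graded unfolding graded_algebra_def by blast+

lemma S_zero: "0 \<in> S i"
proof -
  interpret vector_space scale by (fact vs)
  show ?thesis using S_subspace subspace_0 by auto
qed

text \<open>An injective additive map that raises degrees by d also reflects homogeneity, since it
  maps the homogeneous decomposition of b to that of h b.\<close>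
lemma homogeneous_if_image_homogeneous:
  assumes add: "\<And>a b. h (a + b) = h a + h b" and inj: "\<And>a. h a = 0 \<Longrightarrow> a = (0::'a)"
    and deg: "\<And>j a. a \<in> S j \<Longrightarrow> h a \<in> S (j + d)" and hb: "h b \<in> S (i + d)"
  shows "b \<in> S i"
proof -
  interpret h: additive h by standard (fact add)
  obtain c where c: "\<forall>i. c i \<in> S i" "finite {i. c i \<noteq> 0}" "b = (\<Sum>i | c i \<noteq> 0. c i)"
    using S_decomposition[of b] by blast
  \<comment> \<open>Two decompositions of \<open>h b\<close>: the images of the components of b
    moved up by d, with zeros below degree d, and the one concentrated in degree i + d. Uniqueness
    identifies them, which kills every component of b outside degree i.\<close>
  define c' where "c' k = (if d \<le> k then h (c (k - d)) else 0)" for k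
  define e where "e k = (if k = i + d then h b else 0)" for k
  have hz: "h a = 0 \<longleftrightarrow> a = 0" for a using inj h.zero by auto
  have supp: "{k. c' k \<noteq> 0} = (\<lambda>k. k + d) ` {i. c i \<noteq> 0}"
  proof (intro equalityI subsetI)
    fix k assume "k \<in> {k. c' k \<noteq> 0}"
    then have "k - d \<in> {i. c i \<noteq> 0}" "k = (k - d) + d" by (auto simp: c'_def hz split: if_splits)
    then show "k \<in> (\<lambda>k. k + d) ` {i. c i \<noteq> 0}" by blast
  qed (auto simp: c'_def hz)
  have "h b = (\<Sum>k | c k \<noteq> 0. h (c k))" using c(3) h.sum by metis
  also have "\<dots> = (\<Sum>k | c' k \<noteq> 0. c' k)"
    unfolding supp by (subst sum.reindex) (auto simp: c'_def)
  finally have hb': "h b = (\<Sum>k | c' k \<noteq> 0. c' k)" .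
  have c'S: "c' k \<in> S k" for k
    using deg[of "c (k - d)" "k - d"] c(1) S_zero by (auto simp: c'_def)
  have 1: "(\<forall>i. c' i \<in> S i) \<and> finite {i. c' i \<noteq> 0} \<and> h b = (\<Sum>i | c' i \<noteq> 0. c' i)"
    using c(2) supp c'S hb' by auto
  have "{k. e k \<noteq> 0} \<subseteq> {i + d}" by (auto simp: e_def split: if_splits)
  then have "(\<Sum>k | e k \<noteq> 0. e k) = (\<Sum>k\<in>{i + d}. e k)" by (intro sum.mono_neutral_left) auto
  then have 2: "(\<forall>i. e i \<in> S i) \<and> finite {i. e i \<noteq> 0} \<and> h b = (\<Sum>i | e i \<noteq> 0. e i)"
    using hb S_zero \<open>{k. e k \<noteq> 0} \<subseteq> {i + d}\<close> by (auto simp: e_def intro: finite_subset)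
  have "c' = e" using S_decomposition[of "h b"] 1 2 by blast
  have "c j = 0" if "j \<noteq> i" for j
  proof -
    have "h (c j) = c' (j + d)" by (simp add: c'_def)
    also have "\<dots> = 0" using that \<open>c' = e\<close> by (simp add: e_def)
    finally show ?thesis by (rule inj)
  qed
  then have "{j. c j \<noteq> 0} \<subseteq> {i}" by auto
  then have "b = (\<Sum>j\<in>{i}. c j)" unfolding c(3) by (intro sum.mono_neutral_left) auto
  then show ?thesis using c(1) by simp
qed

section \<open>Existence of the normalizing automorphism and its calculation rules\<close>

lemma S_if_mult_f:
  assumes "b * f \<in> S (i + d)"
  shows "b \<in> S i"
proof (rule homogeneous_if_image_homogeneous[of "\<lambda>a. a * f"])
  show "a * f = 0 \<Longrightarrow> a = 0" for a using regular unfolding regular_element_def by blast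
qed (use assms S_mult f_S in \<open>auto simp: distrib_right\<close>)

lemma S_if_f_mult:
  assumes "f * b \<in> S (i + d)"
  shows "b \<in> S i"
proof (rule homogeneous_if_image_homogeneous[of "\<lambda>a. f * a"])
  show "f * a = 0 \<Longrightarrow> a = 0" for a using regular unfolding regular_element_def by blast
  show "a \<in> S j \<Longrightarrow> f * a \<in> S (j + d)" for a j using S_mult[OF f_S] by (metis add.commute)
qed (use assms in \<open>auto simp: distrib_left\<close>)

text \<open>Normality allows a f to be rewritten as f b, and regularity makes b unique, so b is a
  function of a; rewriting f a as b f gives the inverse function. Degrees are preserved in both
  directions because multiplication by f on either side reflects homogeneity. Uniqueness also
  justifies the definite description.\<close>

lemma normalizing_aut: "graded_automorphism scale S \<nu>" "a * f = f * \<nu> a"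
proof -
  interpret vector_space scale by (fact vs)
  have "a * f \<in> range (\<lambda>b. f * b)" "f * a \<in> range (\<lambda>b. b * f)" for a
    using normal unfolding normal_element_def by blast+
  then have "\<exists>b. a * f = f * b" "\<exists>b. b * f = f * a" for a
    by (auto simp: image_iff) metis
  then obtain n n' where n: "a * f = f * n a" and n': "n' a * f = f * a" for a by metis
  \<comment> \<open>All identities for n below are proved through this uniqueness, that is, after
    multiplication by f on the left.\<close>
  have nI: "n a = b" if "a * f = f * b" for a b using that n cancel_left by metis
  have "graded_automorphism scale S n"
    unfolding graded_automorphism_def
  proof (intro conjI allI)
    have "n (n' a) = a" "n' (n a) = a" for a
      using n' n cancel_right cancel_left by metis+
    then show "bij n" by (metis bijI')
    show "Vector_Spaces.linear scale scale n"
      by unfold_locales (auto intro!: nI simp: distrib_left distrib_right n[symmetric] scale_mult[symmetric])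
    show "n 1 = 1" by (rule nI) simp
    show "n (a * b) = n a * n b" for a b
      by (rule nI) (metis mult.assoc n)
    show "n ` S i = S i" for i
    proof (intro equalityI subsetI)
      fix b assume "b \<in> n ` S i"
      then obtain a where a: "a \<in> S i" "b = n a" by auto
      then have "f * b \<in> S (i + d)" using S_mult[OF a(1) f_S] n by metis
      then show "b \<in> S i" by (rule S_if_f_mult)
    next
      fix b assume "b \<in> S i"
      then have "n' b * f \<in> S (i + d)" using S_mult[OF f_S] n' by (metis add.commute)
      then have "n' b \<in> S i" by (rule S_if_mult_f)
      then show "b \<in> n ` S i" using nI[OF n'] by (metis imageI)
    qed
  qed
  then have "\<exists>!\<mu>. graded_automorphism scale S \<mu> \<and> (\<forall>a. a * f = f * \<mu> a)"
    using n nI by (intro ex1I[of _ n]) (auto intro!: ext)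
  from theI'[OF this] show "graded_automorphism scale S \<nu>" "a * f = f * \<nu> a"
    unfolding normalizing_aut_def by blast+
qed

lemma nu_simps [simp]: "\<nu> (\<nu>' a) = a" "\<nu>' (\<nu> a) = a" "\<nu> 1 = 1" "\<nu>' 1 = 1"
    "\<nu> f = f" "\<nu>' f = f" "\<nu> 0 = 0" "\<nu>' 0 = 0"
  and nu_add: "\<nu> (a + b) = \<nu> a + \<nu> b" "\<nu>' (a + b) = \<nu>' a + \<nu>' b"
  and nu_mult: "\<nu> (a * b) = \<nu> a * \<nu> b" "\<nu>' (a * b) = \<nu>' a * \<nu>' b"
  and nu_S: "\<nu> a \<in> S i \<longleftrightarrow> a \<in> S i" "\<nu>' a \<in> S i \<longleftrightarrow> a \<in> S i"
  and nu_f: "f * \<nu> a = a * f" "f * a = \<nu>' a * f"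
proof -
  have b: "bij \<nu>" and m: "\<And>a b. \<nu> (a * b) = \<nu> a * \<nu> b" and 1: "\<nu> 1 = 1" and im: "\<And>i. \<nu> ` S i = S i"
    using normalizing_aut(1) by (auto simp: graded_automorphism_def)
  interpret Vector_Spaces.linear scale scale \<nu>
    using normalizing_aut(1) by (auto simp: graded_automorphism_def)
  show *: "\<nu> (\<nu>' a) = a" "\<nu>' (\<nu> a) = a" for a
    using b by (simp_all add: bij_is_surj surj_f_inv_f bij_is_inj)
  \<comment> \<open>Cancel f on the left in f f = f \<nu>(f).\<close>
  show "\<nu> f = f" using normalizing_aut(2)[of f] cancel_left by metis
  then show "\<nu>' f = f" by (metis *(2))
  show "\<nu> 1 = 1" by (fact 1)
  then show "\<nu>' 1 = 1" by (metis *(2))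
  show "\<nu> 0 = 0" by (fact zero)
  then show "\<nu>' 0 = 0" by (metis *(2))
  show "\<nu> (a + b) = \<nu> a + \<nu> b" by (fact add)
  show "\<nu>' (a + b) = \<nu>' a + \<nu>' b" by (metis * add)
  show "\<nu> (a * b) = \<nu> a * \<nu> b" by (fact m)
  show "\<nu>' (a * b) = \<nu>' a * \<nu>' b" by (metis * m)
  show "\<nu> a \<in> S i \<longleftrightarrow> a \<in> S i" for a by (metis * im image_iff)
  from this[of "\<nu>' a"] show "\<nu>' a \<in> S i \<longleftrightarrow> a \<in> S i" by (simp add: *)
  show "f * \<nu> a = a * f" for a by (simp add: normalizing_aut(2))
  from this[of "\<nu>' a"] show "f * a = \<nu>' a * f" by (simp add: *)
qed

end

section \<open>Twisted modules\<close>

text \<open>Serves to reindex the unique homogeneous decompositions in a module when its grading is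
  shifted.\<close>

lemma ex1_bij_iff:
  assumes "bij g"
  shows "(\<exists>!x. P (g x)) \<longleftrightarrow> (\<exists>!y. P y)"
proof -
  have g: "g (inv_into UNIV g y) = y" "inv_into UNIV g (g x) = x" for x y
    using assms by (simp_all add: bij_is_surj surj_f_inv_f bij_is_inj)
  show ?thesis
  proof
    assume "\<exists>!x. P (g x)"
    then obtain x where x: "P (g x)" "\<And>x'. P (g x') \<Longrightarrow> x' = x" by blast
    have "y = g x" if "P y" for y using x(2)[of "inv_into UNIV g y"] that g(1)[of y] by simp
    with x(1) show "\<exists>!y. P y" by blast
  next
    assume "\<exists>!y. P y"
    then obtain y where y: "P y" "\<And>y'. P y' \<Longrightarrow> y' = y" by blast
    have "x = inv_into UNIV g y" if "P (g x)" for x using y(2)[OF that] g(2)[of x] by simp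
    moreover have "P (g (inv_into UNIV g y))" using y(1) g(1) by simp
    ultimately show "\<exists>!x. P (g x)" by blast
  qed
qed

context normalized_element
begin

lemma tw_simps [simp]: "carrier (tws M) = carrier M" "madd (tws M) = madd M" "mzero (tws M) = mzero M"
    "act (tws M) x a = act M x (\<nu>' a)" "grade (tws M) i = grade M (i - int d)"
    "add_group (tws M) = add_group M"
  by (simp_all add: tw_def shift_def twist_def add_group_def)

lemma closed_module_tw [simp]: "closed_module (tws M) \<longleftrightarrow> closed_module M"
proof -
  have "(\<forall>i. grade M (i - int d) \<subseteq> carrier M) \<longleftrightarrow> (\<forall>i. grade M i \<subseteq> carrier M)"
    by (metis add_diff_cancel_right')
  moreover have "(\<forall>a. act M x (\<nu>' a) \<in> carrier M) \<longleftrightarrow> (\<forall>a. act M x a \<in> carrier M)" for x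
    by (metis nu_simps(2))
  ultimately show ?thesis by (simp add: closed_module_def)
qed

text \<open>Twisting renames scalars by a bijection and degrees by a translation, so conditions
  quantified over all scalars and all degrees do not change. This is why a homomorphism and its
  twist can be the same function.\<close>

lemma gr_hom_tw [simp]: "gr_hom (tws M) (tws N) = gr_hom M N"
proof -
  have "(\<forall>i. h ` grade M (i - int d) \<subseteq> grade N (i - int d)) \<longleftrightarrow> (\<forall>i. h ` grade M i \<subseteq> grade N i)" for h
    by (metis add_diff_cancel_right')
  moreover have "(\<forall>a. h (act M x (\<nu>' a)) = act N (h x) (\<nu>' a)) \<longleftrightarrow> (\<forall>a. h (act M x a) = act N (h x) a)" for h x
    by (metis nu_simps(2))
  ultimately show ?thesis by (simp add: gr_hom_def)
qed

lemma gr_iso_tw [simp]: "gr_iso (tws M) (tws N) = gr_iso M N"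
  by (simp add: gr_iso_def)

lemma tw_inj: "tws M = tws N \<Longrightarrow> M = N"
proof -
  have "shift (int d) (twist \<nu> (tws M)) = M" for M :: "('a, 'm) rmod"
    by (cases M) (simp add: tw_def shift_def twist_def)
  then show "tws M = tws N \<Longrightarrow> M = N" by metis
qed

lemma tw_surj: "\<exists>N. M = tws N"
  by (rule exI[of _ "shift (int d) (twist \<nu> M)"]) (cases M, simp add: tw_def shift_def twist_def)

text \<open>Invertibility holds literally on records, not just up to isomorphism, so negative
  iterates of the twist can be defined by iterating the inverse function.\<close>

lemma bij_tw: "bij (tws :: ('a, 'm) rmod \<Rightarrow> _)"
  by (rule bijI') (use tw_inj tw_surj in auto)

text \<open>Each axiom is invariant under renaming scalars and degrees. The only one that takes work
  is the unique decomposition, whose index set has to be translated. The form as an equivalence lets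
  the fact pass to negative iterates of the twist.\<close>

lemma graded_right_module_tw [simp]:
  fixes M :: "('a, 'm) rmod"
  shows "graded_right_module S (tws M) \<longleftrightarrow> graded_right_module S M"
proof -
  have closed: "(\<forall>a. act M x (\<nu>' a) \<in> carrier M) \<longleftrightarrow> (\<forall>a. act M x a \<in> carrier M)" for x
    by (metis nu_simps(2))
  have madd: "(\<forall>a. act M (madd M x y) (\<nu>' a) = madd M (act M x (\<nu>' a)) (act M y (\<nu>' a))) \<longleftrightarrow>
      (\<forall>a. act M (madd M x y) a = madd M (act M x a) (act M y a))" for x y
    by (metis nu_simps(2))
  have add: "(\<forall>a b. act M x (\<nu>' (a + b)) = madd M (act M x (\<nu>' a)) (act M x (\<nu>' b))) \<longleftrightarrow>
      (\<forall>a b. act M x (a + b) = madd M (act M x a) (act M x b))" for x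
    by (metis nu_add(2) nu_simps(2))
  have mult: "(\<forall>a b. act M x (\<nu>' (a * b)) = act M (act M x (\<nu>' a)) (\<nu>' b)) \<longleftrightarrow>
      (\<forall>a b. act M x (a * b) = act M (act M x a) b)" for x
    by (metis nu_mult(2) nu_simps(2))
  have alli: "(\<forall>i. P (i - int d)) \<longleftrightarrow> (\<forall>i. P i)" for P by (metis add_diff_cancel_right')
  have decomposition: "(\<exists>!c. (\<forall>i. c i \<in> grade M (i - int d)) \<and> finite {i. c i \<noteq> mzero M} \<and>
        x = finprod (add_group M) c {i. c i \<noteq> mzero M}) \<longleftrightarrow>
      (\<exists>!c. (\<forall>i. c i \<in> grade M i) \<and> finite {i. c i \<noteq> mzero M} \<and>
        x = finprod (add_group M) c {i. c i \<noteq> mzero M})" (is "(\<exists>!c. ?P c) \<longleftrightarrow> (\<exists>!c. ?Q c)")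
    if "comm_group (add_group M)" "\<forall>i. subgroup (grade M i) (add_group M)" for x
  proof -
    interpret comm_group "add_group M" by fact
    \<comment> \<open>Moving the index by d turns a decomposition for the twisted grading into one
      for the original grading, with the same sum.\<close>
    define sh :: "(int \<Rightarrow> 'm) \<Rightarrow> int \<Rightarrow> 'm" where "sh c = (\<lambda>i. c (i + int d))" for c
    have PQ: "?P c \<longleftrightarrow> ?Q (sh c)" for c
    proof (cases "\<forall>i. c i \<in> grade M (i - int d)")
      case True
      have sub: "c i \<in> carrier (add_group M)" for i
        using True that(2) subgroup.subset by blast
      have supp: "{i. c i \<noteq> mzero M} = (\<lambda>i. i + int d) ` {i. sh c i \<noteq> mzero M}"
      proof (intro equalityI subsetI)
        fix i assume "i \<in> {i. c i \<noteq> mzero M}"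
        then have "i - int d \<in> {i. sh c i \<noteq> mzero M}" "i = (i - int d) + int d" by (auto simp: sh_def)
        then show "i \<in> (\<lambda>i. i + int d) ` {i. sh c i \<noteq> mzero M}" by blast
      qed (auto simp: sh_def)
      have inj: "inj_on (\<lambda>i. i + int d) A" for A by (simp add: inj_on_def)
      have "finite {i. c i \<noteq> mzero M} \<longleftrightarrow> finite {i. sh c i \<noteq> mzero M}"
        unfolding supp by (rule finite_image_iff[OF inj])
      moreover have "finprod (add_group M) c {i. c i \<noteq> mzero M} =
          finprod (add_group M) (sh c) {i. sh c i \<noteq> mzero M}"
        unfolding supp using sub by (subst finprod_reindex[OF _ inj]) (auto simp: sh_def)
      moreover have "\<forall>i. sh c i \<in> grade M i"
        using True unfolding sh_def by (metis add_diff_cancel_right')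
      ultimately show ?thesis using True by simp
    next
      case False
      then have "\<not> (\<forall>i. sh c i \<in> grade M i)" unfolding sh_def by (metis diff_add_cancel)
      then show ?thesis using False by blast
    qed
    have "bij sh"
      by (rule o_bij[of "\<lambda>c i. c (i - int d)"]) (auto simp: sh_def)
    then have "(\<exists>!c. ?Q (sh c)) \<longleftrightarrow> (\<exists>!c. ?Q c)" by (rule ex1_bij_iff)
    then show ?thesis by (simp only: PQ)
  qed
  have grading: "(\<forall>i j. \<forall>x\<in>grade M (i - int d). \<forall>a\<in>S j. act M x (\<nu>' a) \<in> grade M (i + int j - int d)) \<longleftrightarrow>
      (\<forall>i j. \<forall>x\<in>grade M i. \<forall>a\<in>S j. act M x a \<in> grade M (i + int j))"
  proof -
    have "(\<forall>a\<in>S j. act M x (\<nu>' a) \<in> A) \<longleftrightarrow> (\<forall>a\<in>S j. act M x a \<in> A)" for x j A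
      by (metis nu_S nu_simps(2))
    then have "(\<forall>i j. \<forall>x\<in>grade M (i - int d). \<forall>a\<in>S j. act M x (\<nu>' a) \<in> grade M (i + int j - int d)) \<longleftrightarrow>
      (\<forall>i j. \<forall>x\<in>grade M (i - int d). \<forall>a\<in>S j. act M x a \<in> grade M (i - int d + int j))"
      by (simp add: algebra_simps)
    then show ?thesis using alli[of "\<lambda>i. \<forall>j. \<forall>x\<in>grade M i. \<forall>a\<in>S j. act M x a \<in> grade M (i + int j)"]
      by simp
  qed
  have subgroups: "(\<forall>i. subgroup (grade M (i - int d)) (add_group M)) \<longleftrightarrow>
      (\<forall>i. subgroup (grade M i) (add_group M))"
    by (rule alli)
  show ?thesis
  \<comment> \<open>Reindexing the finite product requires an abelian group with homogeneous
    subgroups. If this fails, both sides are false.\<close>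
  proof (cases "comm_group (add_group M) \<and> (\<forall>i. subgroup (grade M i) (add_group M))")
    case True
    show ?thesis
      unfolding graded_right_module_def tw_simps nu_simps closed madd add mult grading subgroups
        decomposition[OF True[THEN conjunct1] True[THEN conjunct2]] ..
  next
    case False
    then show ?thesis
      unfolding graded_right_module_def tw_simps subgroups by blast
  qed
qed

section \<open>Twists of free modules\<close>

lemma free_module_simps: "carrier (free_module S r m) = (\<Pi>\<^sub>E s\<in>{..<r}. UNIV)"
    "madd (free_module S r m) x y = (\<lambda>s\<in>{..<r}. x s + y s)"
    "act (free_module S r m) x a = (\<lambda>s\<in>{..<r}. x s * a)"
    "grade (free_module S r m) i = (\<Pi>\<^sub>E s\<in>{..<r}. if i < m s then {0} else S (nat (i - m s)))"
  by (auto simp: free_module_def direct_sum_def shift_def self_module_def algebra_simps intro!: restrict_ext)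

text \<open>Applying \<nu> in every coordinate undoes the twist of the action, as \<nu>(x \<nu>'(a))
  = \<nu>(x) a, while the degree shift of the twist raises every generator degree by d.\<close>

lemma nu_gr_iso_free:
  "(\<lambda>x\<in>carrier (free_module S r m). \<lambda>s\<in>{..<r}. \<nu> (x s))
    \<in> gr_iso (tws (free_module S r m)) (free_module S r (\<lambda>s. m s + int d))" (is "?\<nu> \<in> gr_iso (tws ?M) ?N")
proof -
  define g where "g = (\<lambda>x\<in>carrier ?N. \<lambda>s\<in>{..<r}. \<nu>' (x s))"
  have c: "carrier ?N = carrier ?M" by (simp add: free_module_simps)
  have deg: "(if i - int d < m s then {0} else S (nat (i - int d - m s))) =
      (if i < m s + int d then {0} else S (nat (i - (m s + int d))))" for i s
    by (simp add: algebra_simps)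
  have gN: "grade (tws ?M) i = grade ?N i" for i
    unfolding tw_simps free_module_simps deg ..
  have sub: "grade ?N i \<subseteq> carrier ?N" for i
    using closed_moduleD(3)[OF free_module_closed] by blast
  have z: "\<nu> a \<in> (if b then {0} else S j) \<longleftrightarrow> a \<in> (if b then {0} else S j)"
    "\<nu>' a \<in> (if b then {0} else S j) \<longleftrightarrow> a \<in> (if b then {0} else S j)" for a b j
    using nu_S nu_simps by auto (metis nu_simps)+
  have "?\<nu> \<in> gr_hom (tws ?M) ?N"
  proof (rule gr_homI)
    show "?\<nu> \<in> extensional (carrier (tws ?M))" by simp
    show "?\<nu> x \<in> carrier ?N" if "x \<in> carrier (tws ?M)" for x
      using that by (simp add: free_module_simps)
    show "?\<nu> (madd (tws ?M) x y) = madd ?N (?\<nu> x) (?\<nu> y)"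
      if "x \<in> carrier (tws ?M)" "y \<in> carrier (tws ?M)" for x y
      using that by (simp add: free_module_simps nu_add cong: restrict_cong)
    show "?\<nu> (act (tws ?M) x a) = act ?N (?\<nu> x) a" if "x \<in> carrier (tws ?M)" for x a
      using that by (simp add: free_module_simps nu_mult cong: restrict_cong)
    fix x i assume x: "x \<in> grade (tws ?M) i"
    then have "x \<in> carrier ?M" using sub gN c by blast
    then show "?\<nu> x \<in> grade ?N i" using x z unfolding gN by (auto simp: free_module_simps PiE_iff)
  qed
  moreover have "g \<in> gr_hom ?N (tws ?M)"
  proof (rule gr_homI)
    show "g \<in> extensional (carrier ?N)" by (simp add: g_def)
    show "g x \<in> carrier (tws ?M)" if "x \<in> carrier ?N" for x
      using that by (simp add: free_module_simps g_def)
    show "g (madd ?N x y) = madd (tws ?M) (g x) (g y)"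
      if "x \<in> carrier ?N" "y \<in> carrier ?N" for x y
      using that by (simp add: g_def free_module_simps nu_add cong: restrict_cong)
    show "g (act ?N x a) = act (tws ?M) (g x) a" if "x \<in> carrier ?N" for x a
      using that by (simp add: g_def free_module_simps nu_mult cong: restrict_cong)
    fix x i assume x: "x \<in> grade ?N i"
    then have "x \<in> carrier ?N" using sub by blast
    then show "g x \<in> grade (tws ?M) i" using x z unfolding gN g_def by (auto simp: free_module_simps PiE_iff)
  qed
  moreover have "g (?\<nu> x) = x" "?\<nu> (g x) = x" if "x \<in> carrier ?M" for x
    using that unfolding g_def c by (auto simp: free_module_simps PiE_iff extensional_def)
  ultimately show ?thesis unfolding gr_iso_def tw_simps c by blast
qed

text \<open>The bridge between the two notions of factorization. In coordinates x f = f \<nu>(x), so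
  right multiplication by f becomes left multiplication by f once the trivialization of the twisted
  module is corrected by \<nu>.\<close>

lemma tw_free_iso:
  assumes M: "closed_module M" and \<beta>: "\<beta> \<in> gr_iso M (free_module S r m)"
  shows "\<exists>\<alpha>\<in>gr_iso (tws M) (free_module S r (\<lambda>s. m s + int d)).
    \<forall>x\<in>carrier M. \<beta> (act M x f) = left_mult r f (\<alpha> x)"
proof -
  let ?\<nu> = "\<lambda>x\<in>carrier (free_module S r m). \<lambda>s\<in>{..<r}. \<nu> (x s)"
  have "compose (carrier (tws M)) ?\<nu> \<beta> \<in> gr_iso (tws M) (free_module S r (\<lambda>s. m s + int d))"
    using M \<beta> nu_gr_iso_free by (intro gr_iso_compose[where N = "tws (free_module S r m)"])
      (simp_all add: free_module_closed)
  moreover have "\<beta> (act M x f) = left_mult r f (compose (carrier (tws M)) ?\<nu> \<beta> x)" if "x \<in> carrier M" for x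
    using that gr_homD(2,4)[OF gr_isoD(1)[OF \<beta>], of x]
    by (auto simp: compose_eq left_mult_def free_module_simps nu_f intro!: restrict_ext)
  ultimately show ?thesis by blast
qed

lemma free_iso_if_tw_free_iso:
  assumes M: "closed_module M" and "gr_iso (tws M) (free_module S r m) \<noteq> {}"
  shows "gr_iso M (free_module S r (\<lambda>s. m s - int d)) \<noteq> {}"
proof -
  obtain \<alpha> where \<alpha>: "\<alpha> \<in> gr_iso (tws M) (free_module S r m)" using assms by blast
  let ?N = "free_module S r (\<lambda>s. m s - int d)"
  have "(\<lambda>s. m s - int d + int d) = m" by simp
  with nu_gr_iso_free[of r "\<lambda>s. m s - int d"] obtain \<nu>r
    where "\<nu>r \<in> gr_iso (tws ?N) (free_module S r m)" by auto
  from gr_isoD(3)[OF this] obtain \<nu>r' where "\<nu>r' \<in> gr_iso (free_module S r m) (tws ?N)" by blast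
  then have "compose (carrier (tws M)) \<nu>r' \<alpha> \<in> gr_iso (tws M) (tws ?N)"
    using M \<alpha> by (intro gr_iso_compose) (simp_all add: free_module_closed)
  then show ?thesis by auto
qed

lemma graded_free_tw [simp]: "graded_free S r (tws M) \<longleftrightarrow> graded_free S r M"
proof
  assume a: "graded_free S r (tws M)"
  then show "graded_free S r M"
    using free_iso_if_tw_free_iso[of M r] graded_free_closed[OF a] unfolding graded_free_def by auto
next
  assume a: "graded_free S r M"
  then show "graded_free S r (tws M)"
    using tw_free_iso[of M _ r] graded_free_closed[OF a] unfolding graded_free_def by (simp, blast)
qed

text \<open>In coordinates this is cancellation of the regular element f. It is the source of the
  later identities that are verified only after multiplication by f.\<close>

lemma torsion_free:
  assumes "graded_free S r M" and x: "x \<in> carrier M" and y: "y \<in> carrier M" and eq: "act M x f = act M y f"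
  shows "x = y"
proof -
  obtain m \<beta> where \<beta>: "\<beta> \<in> gr_iso M (free_module S r m)" using assms(1) by (auto simp: graded_free_def)
  note h = gr_isoD(1)[OF \<beta>]
  have "(\<lambda>s\<in>{..<r}. \<beta> x s * f) = (\<lambda>s\<in>{..<r}. \<beta> y s * f)"
    using gr_homD(4)[OF h x, of f] gr_homD(4)[OF h y, of f] eq by (simp add: free_module_simps)
  then have "\<beta> x s = \<beta> y s" if "s < r" for s
    using that cancel_right by (metis lessThan_iff restrict_apply')
  then have "\<beta> x = \<beta> y"
    using gr_homD(2)[OF h x] gr_homD(2)[OF h y] by (intro PiE_ext) (auto simp: free_module_simps)
  then show ?thesis using gr_isoD(2)[OF \<beta>] x y by (auto simp: bij_betw_def inj_on_def)
qed

end

section \<open>Recursion and induction over the integers\<close>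

definition int_power :: "('b \<Rightarrow> 'b) \<Rightarrow> int \<Rightarrow> 'b \<Rightarrow> 'b" where
  "int_power g j = (if 0 \<le> j then g ^^ nat j else inv_into UNIV g ^^ nat (- j))"

lemma int_power_0 [simp]: "int_power g 0 x = x"
  by (simp add: int_power_def)

lemma int_power_add_1:
  assumes "bij g"
  shows "int_power g (j + 1) x = g (int_power g j x)"
proof (cases "0 \<le> j")
  case True
  then have "nat (j + 1) = Suc (nat j)" by simp
  then show ?thesis using True by (simp add: int_power_def)
next
  case False
  then have "nat (- j) = Suc (nat (- (j + 1)))" by simp
  then have "int_power g j x = inv_into UNIV g ((inv_into UNIV g ^^ nat (- (j + 1))) x)"
    using False by (simp add: int_power_def)
  then have "g (int_power g j x) = (inv_into UNIV g ^^ nat (- (j + 1))) x"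
    using assms by (simp add: bij_is_surj surj_f_inv_f)
  then show ?thesis using False by (auto simp: int_power_def)
qed

text \<open>An equivalence between neighbours covers the upward and the downward induction step at
  once.\<close>

lemma int_shift_iff:
  assumes "\<And>j :: int. P (j + 1) \<longleftrightarrow> P j"
  shows "P j \<longleftrightarrow> P 0"
proof (induction j rule: int_induct[where k = 0])
  case (step2 i)
  then show ?case using assms[of "i - 1"] by simp
qed (simp_all add: assms)

text \<open>Reduces to steps of length one by induction on the pair of statements at j and j +
  1.\<close>

lemma int_shift_2_induct:
  assumes "P (0 :: int)" "P 1" "\<And>i. P (i + 2) \<longleftrightarrow> P i"
  shows "P i"
proof -
  have "P (j + 1) \<and> P (j + 1 + 1) \<longleftrightarrow> P j \<and> P (j + 1)" for j
    using assms(3)[of j] by (auto simp: add.assoc)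
  from int_shift_iff[of "\<lambda>j. P j \<and> P (j + 1)" i, OF this] show ?thesis using assms(1,2) by simp
qed

lemma int_power_swap:
  assumes "bij g"
  shows "int_power g j (g x) = g (int_power g j x)"
proof -
  have "int_power g (j + 1) (g x) = g (int_power g (j + 1) x) \<longleftrightarrow>
      int_power g j (g x) = g (int_power g j x)" for j
    using assms by (simp add: int_power_add_1 bij_is_inj inj_eq)
  from int_shift_iff[of "\<lambda>j. int_power g j (g x) = g (int_power g j x)" j, OF this]
  show ?thesis by simp
qed

text \<open>Applies \<open>t\<close> at the indices n - 2, n - 4, and so on, in this order, ending
  at index 0 or 1 according to the parity of n.\<close>

fun ladder :: "(nat \<Rightarrow> 'b \<Rightarrow> 'b) \<Rightarrow> nat \<Rightarrow> 'b \<Rightarrow> 'b" where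
  "ladder t 0 x = x"
| "ladder t (Suc 0) x = x"
| "ladder t (Suc (Suc n)) x = ladder t n (t n x)"

text \<open>Downwards, the recursion runs through the inverses of the \<open>\<theta> i\<close>, along the ladder indexed by
  the distance to 1.\<close>
lemma two_step_recursion:
  fixes C :: "int \<Rightarrow> 'b set"
  assumes inj: "\<And>i. inj_on (\<theta> i) (C (i + 2))"
  shows "\<exists>\<eta>. (\<forall>i. \<eta> i \<in> extensional (C i)) \<and> \<eta> 0 = (\<lambda>x\<in>C 0. x) \<and> \<eta> 1 = (\<lambda>x\<in>C 1. x) \<and>
    (\<forall>i. \<forall>x\<in>C (i + 2). \<theta> i x \<in> C i \<longrightarrow> \<eta> (i + 2) x = \<eta> i (\<theta> i x))"
proof -
  define \<theta>' where "\<theta>' i = inv_into (C (i + 2)) (\<theta> i)" for i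
  \<comment> \<open>For negative positions, the one at distance n + 2 from 1 is - 1 - n, and
    \<open>\<theta>' (- 1 - n)\<close> carries it to the position at distance n. Distances 0 and 1
    are the positions 1 and 0, where the ladder stops.\<close>
  define \<eta> where "\<eta> i = (\<lambda>x\<in>C i. if 0 \<le> i then ladder (\<lambda>n. \<theta> (int n)) (nat i) x
    else ladder (\<lambda>n. \<theta>' (- 1 - int n)) (nat (1 - i)) x)" for i
  have "\<eta> (i + 2) x = \<eta> i (\<theta> i x)" if x: "x \<in> C (i + 2)" "\<theta> i x \<in> C i" for i x
  proof (cases "0 \<le> i")
    case True
    then have "nat (i + 2) = Suc (Suc (nat i))" by simp
    then show ?thesis using True x by (simp add: \<eta>_def)
  next
    case False
    then have "nat (1 - i) = Suc (Suc (nat (- 1 - i)))" by simp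
    moreover have "\<theta>' i (\<theta> i x) = x"
      unfolding \<theta>'_def using inj x(1) by (rule inv_into_f_f)
    ultimately have *: "\<eta> i (\<theta> i x) = ladder (\<lambda>n. \<theta>' (- 1 - int n)) (nat (- 1 - i)) x"
      using False x by (simp add: \<eta>_def)
    \<comment> \<open>For i = - 1 and i = - 2 the position i + 2 already belongs to the upward
      branch; both ladders are the identity there.\<close>
    consider "i + 2 < 0" | "i = - 1" | "i = - 2" using False by linarith
    then show ?thesis
    proof cases
      case 1
      then have "nat (1 - (i + 2)) = nat (- 1 - i)" by simp
      then show ?thesis using 1 x * by (simp add: \<eta>_def)
    qed (use x * in \<open>simp_all add: \<eta>_def\<close>)
  qed
  moreover have "\<eta> 0 = (\<lambda>x\<in>C 0. x)" "\<eta> 1 = (\<lambda>x\<in>C 1. x)"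
    by (auto simp: \<eta>_def intro!: restrict_ext)
  ultimately show ?thesis by (intro exI[of _ \<eta>]) (simp add: \<eta>_def)
qed

section \<open>The categories of factorizations\<close>

lemma compose_ident_right: "g \<in> gr_hom M N \<Longrightarrow> compose (carrier M) g (\<lambda>x\<in>carrier M. x) = g"
  using gr_homD(1)[of g M N] by (auto simp: compose_def extensional_def)

lemma compose_ident_left: "g \<in> gr_hom M N \<Longrightarrow> compose (carrier M) (\<lambda>x\<in>carrier N. x) g = g"
  using gr_homD(1,2)[of g M N] by (auto simp: compose_def extensional_def)

lemma gr_hom_compose_assoc: "g \<in> gr_hom M N \<Longrightarrow>
    compose (carrier M) l (compose (carrier M) h g) = compose (carrier M) (compose (carrier N) l h) g"
  using gr_homD(2)[of g M N] by (auto simp: compose_def)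

lemma free_module_cong: "(\<And>s. s < r \<Longrightarrow> m s = m' s) \<Longrightarrow> free_module S r m = free_module S r m'"
  by (auto simp: free_module_def direct_sum_def intro!: PiE_cong restrict_ext ext)

section \<open>The category of noncommutative factorizations\<close>

lemma is_nmfD:
  assumes "is_nmf S f d X"
  shows "nmap X i \<in> gr_hom (nmod X (i + 1)) (nmod X i)" and "\<exists>r. \<forall>i. graded_free S r (nmod X i)"
    and "closed_module (nmod X i)"
  using assms unfolding is_nmf_def by (blast dest: graded_free_closed)+

lemma is_category_NMF: "is_category (NMF S f d :: (('a::ring_1, 'm) nmf, _) cat)"
  unfolding is_category_def NMF_def cat.simps
proof (intro conjI ballI)
  fix A :: "('a, 'm) nmf" assume A: "A \<in> {X. is_nmf S f d X}"
  show "(\<lambda>i. \<lambda>x\<in>carrier (nmod A i). x) \<in> nmf_hom A A"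
    using A gr_homD(2)[OF is_nmfD(1)[of S f d A]] is_nmfD(3)[of S f d A]
    by (simp add: nmf_hom_def gr_hom_id)
next
  fix A B E :: "('a, 'm) nmf" and g h
  assume A: "A \<in> {X. is_nmf S f d X}" and g: "g \<in> nmf_hom A B" and h: "h \<in> nmf_hom B E"
  note gi = g[unfolded nmf_hom_def mem_Collect_eq, rule_format]
  note hi = h[unfolded nmf_hom_def mem_Collect_eq, rule_format]
  have "compose (carrier (nmod A i)) (h i) (g i) \<in> gr_hom (nmod A i) (nmod E i)" for i
    using is_nmfD(3)[of S f d A] A gi hi by (blast intro: gr_hom_compose)
  moreover have "compose (carrier (nmod A i)) (h i) (g i) (nmap A i x) =
      nmap E i (compose (carrier (nmod A (i + 1))) (h (i + 1)) (g (i + 1)) x)"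
    if x: "x \<in> carrier (nmod A (i + 1))" for i x
  proof -
    have "nmap A i x \<in> carrier (nmod A i)" "g (i + 1) x \<in> carrier (nmod B (i + 1))"
      using x A gr_homD(2)[OF is_nmfD(1)[of S f d A]] gr_homD(2)[of "g (i + 1)"] gi by blast+
    then show ?thesis using x gi hi by (simp add: compose_eq)
  qed
  ultimately show "(\<lambda>i. compose (carrier (nmod A i)) (h i) (g i)) \<in> nmf_hom A E"
    by (simp add: nmf_hom_def)
next
  fix A B :: "('a, 'm) nmf" and g assume "g \<in> nmf_hom A B"
  then have "g i \<in> gr_hom (nmod A i) (nmod B i)" for i by (simp add: nmf_hom_def)
  note gi = compose_ident_right[OF this] compose_ident_left[OF this]
  show "(\<lambda>i. compose (carrier (nmod A i)) (g i) (\<lambda>x\<in>carrier (nmod A i). x)) = g"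
    "(\<lambda>i. compose (carrier (nmod A i)) (\<lambda>x\<in>carrier (nmod B i). x) (g i)) = g"
    by (simp_all only: gi)
next
  fix A B D E :: "('a, 'm) nmf" and g h l assume "g \<in> nmf_hom A B"
  then have "g i \<in> gr_hom (nmod A i) (nmod B i)" for i by (simp add: nmf_hom_def)
  then show "(\<lambda>i. compose (carrier (nmod A i)) (l i) (compose (carrier (nmod A i)) (h i) (g i))) =
    (\<lambda>i. compose (carrier (nmod A i)) (compose (carrier (nmod B i)) (l i) (h i)) (g i))"
    by (intro ext gr_hom_compose_assoc[THEN fun_cong])
qed

section \<open>The category of twisted factorizations\<close>

lemma is_tmfD:
  assumes "is_tmf scale S f d X"
  shows "closed_module (tF X)" "closed_module (tG X)"
    and "\<exists>r. graded_free S r (tF X) \<and> graded_free S r (tG X)"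
    and "tpsi X \<in> gr_hom (tF X) (tG X)" "ttau X \<in> gr_hom (tw scale S f d (tG X)) (tF X)"
    and "x \<in> carrier (tG X) \<Longrightarrow> tpsi X (ttau X x) = act (tG X) x f"
    and "y \<in> carrier (tF X) \<Longrightarrow> ttau X (tpsi X y) = act (tF X) y f"
  using assms unfolding is_tmf_def by (blast dest: graded_free_closed)+

lemma is_category_TMF: "is_category (TMF scale S f d :: (('a::ring_1, 'm) tmf, _) cat)"
  unfolding is_category_def TMF_def cat.simps
proof (intro conjI ballI)
  fix A :: "('a, 'm) tmf" assume A: "A \<in> {X. is_tmf scale S f d X}"
  then show "(\<lambda>x\<in>carrier (tG A). x, \<lambda>x\<in>carrier (tF A). x) \<in> tmf_hom A A"
    using gr_homD(2)[OF is_tmfD(4)[of scale S f d A]] is_tmfD(1,2)[of scale S f d A]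
    by (simp add: tmf_hom_def gr_hom_id)
next
  fix A B E :: "('a, 'm) tmf" and g h
  assume A: "A \<in> {X. is_tmf scale S f d X}" and g: "g \<in> tmf_hom A B" and h: "h \<in> tmf_hom B E"
  obtain gG gF hG hF where gh: "g = (gG, gF)" "h = (hG, hF)" by (cases g, cases h) auto
  have gi: "gG \<in> gr_hom (tG A) (tG B)" "gF \<in> gr_hom (tF A) (tF B)"
    "\<And>x. x \<in> carrier (tF A) \<Longrightarrow> gG (tpsi A x) = tpsi B (gF x)"
    using g by (auto simp: gh tmf_hom_def)
  have hi: "hG \<in> gr_hom (tG B) (tG E)" "hF \<in> gr_hom (tF B) (tF E)"
    "\<And>x. x \<in> carrier (tF B) \<Longrightarrow> hG (tpsi B x) = tpsi E (hF x)"
    using h by (auto simp: gh tmf_hom_def)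
  have "x \<in> carrier (tF A) \<Longrightarrow> tpsi A x \<in> carrier (tG A)" for x
    using A is_tmfD(4)[of scale S f d A] by (auto intro: gr_homD(2))
  moreover have "x \<in> carrier (tF A) \<Longrightarrow> gF x \<in> carrier (tF B)" for x
    using gi(2) by (rule gr_homD(2))
  ultimately show "(compose (carrier (tG A)) (fst h) (fst g), compose (carrier (tF A)) (snd h) (snd g)) \<in> tmf_hom A E"
    using A is_tmfD(1,2)[of scale S f d A] gi hi
    by (auto simp: gh tmf_hom_def compose_eq intro: gr_hom_compose)
next
  fix A B :: "('a, 'm) tmf" and g assume "g \<in> tmf_hom A B"
  then obtain gG gF where "g = (gG, gF)" "gG \<in> gr_hom (tG A) (tG B)" "gF \<in> gr_hom (tF A) (tF B)"
    by (auto simp: tmf_hom_def)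
  then show "(compose (carrier (tG A)) (fst g) (fst (\<lambda>x\<in>carrier (tG A). x, \<lambda>x\<in>carrier (tF A). x)),
      compose (carrier (tF A)) (snd g) (snd (\<lambda>x\<in>carrier (tG A). x, \<lambda>x\<in>carrier (tF A). x))) = g"
    "(compose (carrier (tG A)) (fst (\<lambda>x\<in>carrier (tG B). x, \<lambda>x\<in>carrier (tF B). x)) (fst g),
      compose (carrier (tF A)) (snd (\<lambda>x\<in>carrier (tG B). x, \<lambda>x\<in>carrier (tF B). x)) (snd g)) = g"
    by (simp_all only: fst_conv snd_conv compose_ident_left compose_ident_right)
next
  fix A B D E :: "('a, 'm) tmf" and g h l assume "g \<in> tmf_hom A B"
  then obtain gG gF where "g = (gG, gF)" "gG \<in> gr_hom (tG A) (tG B)" "gF \<in> gr_hom (tF A) (tF B)"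
    by (auto simp: tmf_hom_def)
  then show "(compose (carrier (tG A)) (fst l) (fst (compose (carrier (tG A)) (fst h) (fst g), compose (carrier (tF A)) (snd h) (snd g))),
     compose (carrier (tF A)) (snd l) (snd (compose (carrier (tG A)) (fst h) (fst g), compose (carrier (tF A)) (snd h) (snd g)))) =
    (compose (carrier (tG A)) (fst (compose (carrier (tG B)) (fst l) (fst h), compose (carrier (tF B)) (snd l) (snd h))) (fst g),
     compose (carrier (tF A)) (snd (compose (carrier (tG B)) (fst l) (fst h), compose (carrier (tF B)) (snd l) (snd h))) (snd g))"
    by (simp only: fst_conv snd_conv gr_hom_compose_assoc)
qed

text \<open>The inverses of the components commute with the maps automatically: apply them to the
  commuting squares of \<open>\<mu>\<close>.\<close>

lemma is_iso_NMF:
  assumes X: "is_nmf S f d X" and Y: "is_nmf S f d Y" and \<mu>: "\<mu> \<in> nmf_hom X Y"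
    and iso: "\<And>i. \<mu> i \<in> gr_iso (nmod X i) (nmod Y i)"
  shows "is_iso (NMF S f d) X Y \<mu>"
proof -
  have "\<forall>i. \<exists>g. g \<in> gr_iso (nmod Y i) (nmod X i) \<and> (\<forall>x\<in>carrier (nmod X i). g (\<mu> i x) = x) \<and>
      (\<forall>y\<in>carrier (nmod Y i). \<mu> i (g y) = y)"
    using gr_isoD(3)[OF iso] by blast
  from choice[OF this] obtain \<kappa> where \<kappa>: "\<kappa> i \<in> gr_hom (nmod Y i) (nmod X i)"
    "x \<in> carrier (nmod X i) \<Longrightarrow> \<kappa> i (\<mu> i x) = x" "y \<in> carrier (nmod Y i) \<Longrightarrow> \<mu> i (\<kappa> i y) = y" for i x y
    using gr_isoD(1) by blast
  have \<mu>h: "\<mu> i \<in> gr_hom (nmod X i) (nmod Y i)" for i using iso by (rule gr_isoD(1))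
  have "\<kappa> i (nmap Y i y) = nmap X i (\<kappa> (i + 1) y)" if y: "y \<in> carrier (nmod Y (i + 1))" for i y
  proof -
    have k: "\<kappa> (i + 1) y \<in> carrier (nmod X (i + 1))" using gr_homD(2)[OF \<kappa>(1) y] .
    then have "\<mu> i (nmap X i (\<kappa> (i + 1) y)) = nmap Y i y"
      using \<mu> \<kappa>(3)[OF y] by (simp add: nmf_hom_def)
    then show ?thesis using \<kappa>(2)[OF gr_homD(2)[OF is_nmfD(1)[OF X] k]] by simp
  qed
  then have "\<kappa> \<in> nmf_hom Y X" using \<kappa>(1) by (simp add: nmf_hom_def)
  moreover have "compose (carrier (nmod X i)) (\<kappa> i) (\<mu> i) = (\<lambda>x\<in>carrier (nmod X i). x)"
    "compose (carrier (nmod Y i)) (\<mu> i) (\<kappa> i) = (\<lambda>x\<in>carrier (nmod Y i). x)" for i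
    using \<kappa>(2,3) by (auto simp: compose_def intro!: restrict_ext)
  ultimately show ?thesis using \<mu> unfolding is_iso_def NMF_def cat.simps by auto
qed

section \<open>Unrolling twisted factorizations\<close>

lemma int_index: "i + 1 + 1 = i + 2" "i + 1 + 2 = i + 3" "i + 2 + 1 = i + (3::int)"
  by simp_all

text \<open>Positions 2j and 2j + 1 of the unrolled sequence carry the j-fold twists of G and F;
  this is the module before twisting. With G at even positions, \<open>tpsi T\<close> runs from
  position 1 to position 0.\<close>

definition tcomponent :: "('a, 'm) tmf \<Rightarrow> int \<Rightarrow> ('a, 'm) rmod" where
  "tcomponent T i = (if even i then tG T else tF T)"

context normalized_element
begin

section \<open>Iterated twists\<close>

definition twn :: "int \<Rightarrow> ('a, 'm) rmod \<Rightarrow> ('a, 'm) rmod" where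
  "twn = int_power tws"

lemma twn_0 [simp]: "twn 0 M = M"
  by (simp add: twn_def)

lemma twn_add_1: "twn (j + 1) M = tws (twn j M)" "twn (j + 1) M = twn j (tws M)"
  by (simp_all add: twn_def int_power_add_1 int_power_swap bij_tw)

lemma twn_invariant:
  assumes "\<And>N. P (tws N) \<longleftrightarrow> P N"
  shows "P (twn j M) \<longleftrightarrow> P M"
  using int_shift_iff[of "\<lambda>j. P (twn j M)" j] by (simp add: twn_add_1(1) assms)

text \<open>Twisting changes the action in general, but not that of f, because \<nu> fixes
  f.\<close>

lemma twn_simps [simp]: "carrier (twn j M) = carrier M" "act (twn j M) x f = act M x f"
    "closed_module (twn j M) \<longleftrightarrow> closed_module M" "graded_free S r (twn j M) \<longleftrightarrow> graded_free S r M"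
  using twn_invariant[of "\<lambda>N. carrier N = carrier M" j M]
    twn_invariant[of "\<lambda>N. act N x f = act M x f" j M]
    twn_invariant[of closed_module j M] twn_invariant[of "graded_free S r" j M] by simp_all

lemma gr_hom_twn [simp]: "gr_hom (twn j M) (twn j N) = gr_hom M N"
  using int_shift_iff[of "\<lambda>j. gr_hom (twn j M) (twn j N) = gr_hom M N" j] by (simp add: twn_add_1(1))

lemma twn_free_iso:
  assumes "closed_module M" "gr_iso M (free_module S r m) \<noteq> {}"
  shows "gr_iso (twn j M) (free_module S r (\<lambda>s. m s + j * int d)) \<noteq> {}"
proof -
  have "gr_iso (twn (j + 1) M) (free_module S r (\<lambda>s. m s + (j + 1) * int d)) \<noteq> {} \<longleftrightarrow>
      gr_iso (twn j M) (free_module S r (\<lambda>s. m s + j * int d)) \<noteq> {}" for j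
  proof -
    have c: "closed_module (twn j M)" using assms(1) by simp
    have "(\<lambda>s. m s + (j + 1) * int d) = (\<lambda>s. m s + j * int d + int d)" by (simp add: algebra_simps)
    then show ?thesis
      using free_iso_if_tw_free_iso[OF c, of r "\<lambda>s. m s + j * int d + int d"]
        tw_free_iso[OF c, of _ r "\<lambda>s. m s + j * int d"] by (auto simp: twn_add_1(1))
  qed
  from int_shift_iff[of "\<lambda>j. gr_iso (twn j M) (free_module S r (\<lambda>s. m s + j * int d)) \<noteq> {}" j, OF this]
  show ?thesis using assms(2) by simp
qed

section \<open>The unrolled sequence of a twisted factorization\<close>

definition unroll :: "('a, 'm) tmf \<Rightarrow> ('a, 'm) nmf" where
  "unroll T = \<lparr>nmod = \<lambda>i. twn (i div 2) (tcomponent T i), nmap = \<lambda>i. if even i then tpsi T else ttau T\<rparr>"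

lemma nmod_unroll_add_2: "nmod (unroll T) (i + 2) = tws (nmod (unroll T) i)"
  by (simp add: unroll_def tcomponent_def twn_add_1(1)[symmetric])

lemma carrier_nmod_unroll [simp]: "carrier (nmod (unroll T) i) = carrier (tcomponent T i)"
  and act_nmod_unroll [simp]: "act (nmod (unroll T) i) x f = act (tcomponent T i) x f"
  by (simp_all add: unroll_def)

lemma gr_hom_nmod_unroll [simp]:
  "gr_hom (nmod (unroll T) i) (nmod (unroll U) i) = gr_hom (tcomponent T i) (tcomponent U i)"
  by (simp add: unroll_def)

lemma nmap_nmap_unroll:
  assumes "is_tmf scale S f d T" "x \<in> carrier (tcomponent T i)"
  shows "nmap (unroll T) i (nmap (unroll T) (i + 1) x) = act (tcomponent T i) x f"
  using assms by (auto simp: unroll_def tcomponent_def is_tmfD(6,7) split: if_splits)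

text \<open>Two consecutive maps compose to right multiplication by f. For any trivialization
  \<beta> at position i, \<open>tw_free_iso\<close> supplies the trivialization \<alpha> of the
  twist at position i + 2 that turns this into left multiplication by f.\<close>

lemma is_nmf_unroll:
  fixes T :: "('a, 'm) tmf"
  assumes T: "is_tmf scale S f d T"
  shows "is_nmf S f d (unroll T)"
proof -
  have "nmap (unroll T) i \<in> gr_hom (nmod (unroll T) (i + 1)) (nmod (unroll T) i)" for i
  proof (cases "even i")
    case True
    then have "(i + 1) div 2 = i div 2" by presburger
    then show ?thesis using True is_tmfD(4)[OF T] by (simp add: unroll_def tcomponent_def)
  next
    case False
    \<comment> \<open>Going from an odd position to the next one adds a twist, and this is exactly
      the twist in the domain of \<open>ttau T\<close>.\<close>
    then have "(i + 1) div 2 = i div 2 + 1" by presburger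
    then show ?thesis using False is_tmfD(5)[OF T] by (simp add: unroll_def tcomponent_def twn_add_1(2))
  qed
  moreover obtain r where r: "graded_free S r (tF T)" "graded_free S r (tG T)" using is_tmfD(3)[OF T] by blast
  moreover have "graded_free S r (nmod (unroll T) i)" for i
    using r by (simp add: unroll_def tcomponent_def)
  moreover obtain mF mG where m: "gr_iso (tF T) (free_module S r mF) \<noteq> {}" "gr_iso (tG T) (free_module S r mG) \<noteq> {}"
    using r by (auto simp: graded_free_def)
  \<comment> \<open>Each twist raises the generator degrees by d, and \<open>i div 2\<close> counts
    the twists at position i.\<close>
  define m :: "int \<Rightarrow> nat \<Rightarrow> int"
    where "m i s = (if even i then mG s else mF s) + i div 2 * int d" for i s
  have m2: "m (i + 2) = (\<lambda>s. m i s + int d)" for i by (auto simp: m_def algebra_simps)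
  have "\<exists>\<alpha>\<in>gr_iso (nmod (unroll T) (i + 2)) (free_module S r (m (i + 2))).
      \<exists>\<beta>\<in>gr_iso (nmod (unroll T) i) (free_module S r (m i)).
        \<forall>x\<in>carrier (nmod (unroll T) (i + 2)).
          \<beta> (nmap (unroll T) i (nmap (unroll T) (i + 1) x)) = left_mult r f (\<alpha> x)" for i
  proof -
    have c: "closed_module (tcomponent T i)" using is_tmfD(1,2)[OF T] by (simp add: tcomponent_def)
    have "gr_iso (nmod (unroll T) i) (free_module S r (m i)) \<noteq> {}"
      using twn_free_iso[OF c, of r "if even i then mG else mF" "i div 2"] m
      by (cases "even i") (simp_all add: unroll_def tcomponent_def m_def[abs_def])
    then obtain \<beta> where \<beta>: "\<beta> \<in> gr_iso (nmod (unroll T) i) (free_module S r (m i))" by blast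
    have c': "closed_module (nmod (unroll T) i)" using c by (simp add: unroll_def)
    from tw_free_iso[OF c' \<beta>] \<beta> show ?thesis
      unfolding nmod_unroll_add_2 m2 using nmap_nmap_unroll[OF T] by auto
  qed
  then have "\<forall>i. (\<forall>s<r. m (i + 2) s = m i s + int d) \<and>
      (\<exists>\<alpha>\<in>gr_iso (nmod (unroll T) (i + 2)) (free_module S r (m (i + 2))).
        \<exists>\<beta>\<in>gr_iso (nmod (unroll T) i) (free_module S r (m i)).
          \<forall>x\<in>carrier (nmod (unroll T) (i + 2)).
            \<beta> (nmap (unroll T) i (nmap (unroll T) (i + 1) x)) = left_mult r f (\<alpha> x))"
    by (simp add: m2)
  ultimately show ?thesis unfolding is_nmf_def by blast
qed

section \<open>Full faithfulness of the unrolling\<close>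

definition unroll_hom :: "('m \<Rightarrow> 'm) \<times> ('m \<Rightarrow> 'm) \<Rightarrow> int \<Rightarrow> 'm \<Rightarrow> 'm" where
  "unroll_hom \<mu> i = (if even i then fst \<mu> else snd \<mu>)"

lemma unroll_hom_in:
  fixes T U :: "('a, 'm) tmf"
  assumes T: "is_tmf scale S f d T" and U: "is_tmf scale S f d U" and \<mu>: "\<mu> \<in> tmf_hom T U"
  shows "unroll_hom \<mu> \<in> nmf_hom (unroll T) (unroll U)"
proof -
  obtain \<mu>G \<mu>F where eq: "\<mu> = (\<mu>G, \<mu>F)" by (cases \<mu>)
  then have G: "\<mu>G \<in> gr_hom (tG T) (tG U)" and F: "\<mu>F \<in> gr_hom (tF T) (tF U)"
    and psi: "\<And>x. x \<in> carrier (tF T) \<Longrightarrow> \<mu>G (tpsi T x) = tpsi U (\<mu>F x)"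
    using \<mu> by (auto simp: tmf_hom_def)
  obtain r where r: "graded_free S r (tF U)" using is_tmfD(3)[OF U] by blast
  have tau: "\<mu>F (ttau T x) = ttau U (\<mu>G x)" if x: "x \<in> carrier (tG T)" for x
  proof -
    have tx: "ttau T x \<in> carrier (tF T)" using gr_homD(2)[OF is_tmfD(5)[OF T]] x by simp
    have gx: "\<mu>G x \<in> carrier (tG U)" using gr_homD(2)[OF G x] .
    have fx: "\<mu>F (ttau T x) \<in> carrier (tF U)" using gr_homD(2)[OF F tx] .
    have tgx: "ttau U (\<mu>G x) \<in> carrier (tF U)" using gr_homD(2)[OF is_tmfD(5)[OF U]] gx by simp
    \<comment> \<open>Both candidates agree after \<open>tpsi U\<close>, since the composite of
      \<open>ttau\<close> and \<open>tpsi\<close> is multiplication by f. Applying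
      \<open>ttau U\<close> turns this into equality after multiplication by f in F, where f
      cancels.\<close>
    have "tpsi U (\<mu>F (ttau T x)) = \<mu>G (act (tG T) x f)"
      by (simp only: psi[OF tx, symmetric] is_tmfD(6)[OF T x])
    also have "\<dots> = tpsi U (ttau U (\<mu>G x))"
      by (simp only: gr_homD(4)[OF G x] is_tmfD(6)[OF U gx])
    finally have "act (tF U) (\<mu>F (ttau T x)) f = act (tF U) (ttau U (\<mu>G x)) f"
      using is_tmfD(7)[OF U fx] is_tmfD(7)[OF U tgx] by simp
    then show ?thesis by (rule torsion_free[OF r fx tgx])
  qed
  have "unroll_hom \<mu> i \<in> gr_hom (nmod (unroll T) i) (nmod (unroll U) i)" for i
    using F G by (simp add: unroll_hom_def eq tcomponent_def)
  moreover have "unroll_hom \<mu> i (nmap (unroll T) i x) = nmap (unroll U) i (unroll_hom \<mu> (i + 1) x)"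
    if "x \<in> carrier (nmod (unroll T) (i + 1))" for i x
    using that psi tau by (auto simp: unroll_hom_def eq tcomponent_def unroll_def)
  ultimately show ?thesis by (simp add: nmf_hom_def)
qed

text \<open>Two adjacent commuting squares give \<kappa>(i)(x f) = \<kappa>(i + 2)(x) f. The left
  side is \<kappa>(i)(x) f by linearity, and f cancels.\<close>

lemma nmf_hom_unroll_periodic:
  fixes T U :: "('a, 'm) tmf"
  assumes T: "is_tmf scale S f d T" and U: "is_tmf scale S f d U" and \<kappa>: "\<kappa> \<in> nmf_hom (unroll T) (unroll U)"
  shows "\<kappa> = unroll_hom (\<kappa> 0, \<kappa> 1)"
proof
  fix i
  have h: "\<kappa> i \<in> gr_hom (tcomponent T i) (tcomponent U i)" for i
    using \<kappa> unfolding nmf_hom_def by simp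
  have c: "\<kappa> i (nmap (unroll T) i x) = nmap (unroll U) i (\<kappa> (i + 1) x)"
    if "x \<in> carrier (tcomponent T (i + 1))" for i x
    using \<kappa> that unfolding nmf_hom_def by simp
  have t2: "tcomponent V (i + 2) = tcomponent V i" for V :: "('a, 'm) tmf" and i
    by (simp add: tcomponent_def)
  have per: "\<kappa> (i + 2) = \<kappa> i" for i
  proof (rule gr_hom_eqI)
    show "\<kappa> (i + 2) \<in> gr_hom (tcomponent T i) (tcomponent U i)" using h[of "i + 2"] by (simp only: t2)
    show "\<kappa> i \<in> gr_hom (tcomponent T i) (tcomponent U i)" by (fact h)
    fix x assume x: "x \<in> carrier (tcomponent T i)"
    have x1: "nmap (unroll T) (i + 1) x \<in> carrier (tcomponent T (i + 1))"
      using gr_homD(2)[OF is_nmfD(1)[OF is_nmf_unroll[OF T], of "i + 1"], of x] x by (simp add: t2 int_index)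
    have kx: "\<kappa> (i + 2) x \<in> carrier (tcomponent U i)"
      using gr_homD(2)[OF h[of "i + 2"], of x] x by (simp add: t2)
    have "act (tcomponent U i) (\<kappa> i x) f = \<kappa> i (nmap (unroll T) i (nmap (unroll T) (i + 1) x))"
      using gr_homD(4)[OF h x] nmap_nmap_unroll[OF T x] by simp
    also have "\<dots> = nmap (unroll U) i (nmap (unroll U) (i + 1) (\<kappa> (i + 2) x))"
      using c[OF x1] c[of x "i + 1"] x by (simp add: t2 int_index)
    also have "\<dots> = act (tcomponent U i) (\<kappa> (i + 2) x) f"
      by (rule nmap_nmap_unroll[OF U kx])
    finally have eq: "act (tcomponent U i) (\<kappa> (i + 2) x) f = act (tcomponent U i) (\<kappa> i x) f" by simp
    obtain r where "graded_free S r (tcomponent U i)"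
      using is_tmfD(3)[OF U] by (cases "even i") (auto simp: tcomponent_def)
    from torsion_free[OF this kx gr_homD(2)[OF h x] eq] show "\<kappa> (i + 2) x = \<kappa> i x" .
  qed
  show "\<kappa> i = unroll_hom (\<kappa> 0, \<kappa> 1) i"
    by (rule int_shift_2_induct[of "\<lambda>i. \<kappa> i = unroll_hom (\<kappa> 0, \<kappa> 1) i"])
      (simp_all add: per unroll_hom_def)
qed

text \<open>The inverse restricts a morphism to positions 0 and 1, where the square at position 0 is
  the condition on \<open>tpsi\<close>.\<close>

lemma bij_betw_unroll_hom:
  fixes T U :: "('a, 'm) tmf"
  assumes T: "is_tmf scale S f d T" and U: "is_tmf scale S f d U"
  shows "bij_betw unroll_hom (tmf_hom T U) (nmf_hom (unroll T) (unroll U))"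
proof (rule bij_betw_byWitness[where f' = "\<lambda>\<kappa>. (\<kappa> 0, \<kappa> 1)"])
  show "\<forall>\<mu>\<in>tmf_hom T U. (unroll_hom \<mu> 0, unroll_hom \<mu> 1) = \<mu>"
    by (simp add: unroll_hom_def)
  show "\<forall>\<kappa>\<in>nmf_hom (unroll T) (unroll U). unroll_hom (\<kappa> 0, \<kappa> 1) = \<kappa>"
    using nmf_hom_unroll_periodic[OF T U] by simp
  show "unroll_hom ` tmf_hom T U \<subseteq> nmf_hom (unroll T) (unroll U)"
    using unroll_hom_in[OF T U] by blast
  show "(\<lambda>\<kappa>. (\<kappa> 0, \<kappa> 1)) ` nmf_hom (unroll T) (unroll U) \<subseteq> tmf_hom T U"
  proof (intro image_subsetI)
    fix \<kappa> assume \<kappa>: "\<kappa> \<in> nmf_hom (unroll T) (unroll U)"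
    then have "\<kappa> i \<in> gr_hom (tcomponent T i) (tcomponent U i)" for i unfolding nmf_hom_def by simp
    from this[of 0] this[of 1] have "\<kappa> 0 \<in> gr_hom (tG T) (tG U)" "\<kappa> 1 \<in> gr_hom (tF T) (tF U)"
      by (simp_all add: tcomponent_def)
    moreover have "\<kappa> 0 (tpsi T x) = tpsi U (\<kappa> 1 x)" if "x \<in> carrier (tF T)" for x
    proof -
      have "\<forall>x\<in>carrier (nmod (unroll T) (0 + 1)). \<kappa> 0 (nmap (unroll T) 0 x) = nmap (unroll U) 0 (\<kappa> (0 + 1) x)"
        using \<kappa> unfolding nmf_hom_def by blast
      then show ?thesis using that by (simp add: tcomponent_def) (simp add: unroll_def)
    qed
    ultimately show "(\<kappa> 0, \<kappa> 1) \<in> tmf_hom T U" by (simp add: tmf_hom_def)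
  qed
qed

section \<open>The unrolling functor and its essential surjectivity\<close>

lemma is_functor_unroll:
  "is_functor (TMF scale S f d :: (('a, 'm) tmf, _) cat) (NMF S f d) unroll (\<lambda>_ _. unroll_hom)"
  unfolding is_functor_def NMF_def TMF_def cat.simps
  using is_nmf_unroll unroll_hom_in by (auto simp: unroll_hom_def tcomponent_def fun_eq_iff)

text \<open>The factorization provides trivializations with \<beta>(\<phi> \<phi> x) = f
  \<alpha>(x), and \<open>tw_free_iso\<close> provides \<alpha>' with \<beta>(x f) = f \<alpha>'(x)
  for the same \<beta>. Hence \<theta> is \<alpha> followed by the inverse of \<alpha>', and
  injectivity of \<beta> gives the equation.\<close>

lemma period_iso:
  fixes X :: "('a, 'm) nmf"
  assumes X: "is_nmf S f d X"
  shows "\<exists>\<theta>\<in>gr_iso (nmod X (i + 2)) (tws (nmod X i)).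
    \<forall>x\<in>carrier (nmod X (i + 2)). act (nmod X i) (\<theta> x) f = nmap X i (nmap X (i + 1) x)"
proof -
  obtain r m \<alpha> \<beta> where m: "\<forall>s<r. m (i + 2) s = m i s + int d"
    and \<alpha>: "\<alpha> \<in> gr_iso (nmod X (i + 2)) (free_module S r (m (i + 2)))"
    and \<beta>: "\<beta> \<in> gr_iso (nmod X i) (free_module S r (m i))"
    and eq: "\<forall>x\<in>carrier (nmod X (i + 2)). \<beta> (nmap X i (nmap X (i + 1) x)) = left_mult r f (\<alpha> x)"
    using X unfolding is_nmf_def by blast
  have c: "closed_module (nmod X i)" "closed_module (nmod X (i + 2))" using is_nmfD(3)[OF X] by blast+
  have "free_module S r (m (i + 2)) = free_module S r (\<lambda>s. m i s + int d)"
    using m by (intro free_module_cong) blast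
  with tw_free_iso[OF c(1) \<beta>] obtain \<alpha>' where \<alpha>': "\<alpha>' \<in> gr_iso (tws (nmod X i)) (free_module S r (m (i + 2)))"
    and \<alpha>'f: "\<forall>x\<in>carrier (nmod X i). \<beta> (act (nmod X i) x f) = left_mult r f (\<alpha>' x)" by metis
  obtain \<gamma> where \<gamma>: "\<gamma> \<in> gr_iso (free_module S r (m (i + 2))) (tws (nmod X i))"
    "\<forall>y\<in>carrier (free_module S r (m (i + 2))). \<alpha>' (\<gamma> y) = y"
    using gr_isoD(3)[OF \<alpha>'] by blast
  let ?\<theta> = "compose (carrier (nmod X (i + 2))) \<gamma> \<alpha>"
  have "?\<theta> \<in> gr_iso (nmod X (i + 2)) (tws (nmod X i))"
    using c \<alpha> \<gamma>(1) by (intro gr_iso_compose) simp_all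
  moreover have "act (nmod X i) (?\<theta> x) f = nmap X i (nmap X (i + 1) x)" if x: "x \<in> carrier (nmod X (i + 2))" for x
  proof -
    have ax: "\<alpha> x \<in> carrier (free_module S r (m (i + 2)))" using gr_homD(2)[OF gr_isoD(1)[OF \<alpha>] x] .
    then have gx: "\<gamma> (\<alpha> x) \<in> carrier (nmod X i)" using gr_homD(2)[OF gr_isoD(1)[OF \<gamma>(1)]] by simp
    have "nmap X (i + 1) x \<in> carrier (nmod X (i + 1))"
      using gr_homD(2)[OF is_nmfD(1)[OF X, of "i + 1"], of x] x by (simp add: int_index)
    then have nn: "nmap X i (nmap X (i + 1) x) \<in> carrier (nmod X i)"
      using gr_homD(2)[OF is_nmfD(1)[OF X]] by blast
    have "\<beta> (act (nmod X i) (?\<theta> x) f) = \<beta> (nmap X i (nmap X (i + 1) x))"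
      using x gx ax \<alpha>'f \<gamma>(2) eq by (simp add: compose_eq)
    then show ?thesis
      using gr_isoD(2)[OF \<beta>] nn closed_moduleD(2)[OF c(1) gx] x
      by (auto simp: bij_betw_def inj_on_def compose_eq)
  qed
  ultimately show ?thesis by blast
qed

lemma unroll_essentially_surjective:
  fixes X :: "('a, 'm) nmf"
  assumes X: "is_nmf S f d X"
  shows "\<exists>T. is_tmf scale S f d T \<and> (\<exists>\<mu>. is_iso (NMF S f d) X (unroll T) \<mu>)"
proof -
  let ?M = "nmod X" and ?\<phi> = "nmap X"
  have "\<forall>i. \<exists>\<theta>. \<theta> \<in> gr_iso (?M (i + 2)) (tws (?M i)) \<and>
      (\<forall>x\<in>carrier (?M (i + 2)). act (?M i) (\<theta> x) f = ?\<phi> i (?\<phi> (i + 1) x))"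
    using period_iso[OF X] by blast
  from choice[OF this] obtain \<theta> where \<theta>: "\<theta> i \<in> gr_iso (?M (i + 2)) (tws (?M i))"
    and \<theta>f: "x \<in> carrier (?M (i + 2)) \<Longrightarrow> act (?M i) (\<theta> i x) f = ?\<phi> i (?\<phi> (i + 1) x)" for i x by blast
  obtain r where r: "\<And>i. graded_free S r (?M i)" using is_nmfD(2)[OF X] by blast
  have cl: "closed_module (?M i)" for i by (rule is_nmfD(3)[OF X])
  have \<phi>: "?\<phi> i \<in> gr_hom (?M (i + 1)) (?M i)" for i by (rule is_nmfD(1)[OF X])
  have \<phi>c: "?\<phi> i x \<in> carrier (?M i)" if "x \<in> carrier (?M (i + 1))" for i x
    using gr_homD(2)[OF \<phi> that] .
  have \<theta>c: "\<theta> i x \<in> carrier (?M i)" if "x \<in> carrier (?M (i + 2))" for i x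
    using gr_homD(2)[OF gr_isoD(1)[OF \<theta>] that] by simp
  \<comment> \<open>Multiplied by f, both sides become the composite of the three maps
    \<open>?\<phi> i\<close>, \<open>?\<phi> (i + 1)\<close>, \<open>?\<phi> (i + 2)\<close> at
    y.\<close>
  have natural: "\<theta> i (?\<phi> (i + 2) y) = ?\<phi> i (\<theta> (i + 1) y)" if y: "y \<in> carrier (?M (i + 3))" for i y
  proof -
    have y2: "?\<phi> (i + 2) y \<in> carrier (?M (i + 2))" using \<phi>c[of y "i + 2"] y by (simp add: int_index)
    have y1: "\<theta> (i + 1) y \<in> carrier (?M (i + 1))" using \<theta>c[of y "i + 1"] y by (simp add: int_index)
    have "act (?M i) (\<theta> i (?\<phi> (i + 2) y)) f = ?\<phi> i (act (?M (i + 1)) (\<theta> (i + 1) y) f)"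
      using \<theta>f[OF y2] \<theta>f[of y "i + 1"] y by (simp add: int_index)
    also have "\<dots> = act (?M i) (?\<phi> i (\<theta> (i + 1) y)) f" by (rule gr_homD(4)[OF \<phi> y1])
    finally show ?thesis by (rule torsion_free[OF r \<theta>c[OF y2] \<phi>c[OF y1]])
  qed
  have "\<forall>i. \<exists>g. g \<in> gr_iso (tws (?M i)) (?M (i + 2)) \<and> (\<forall>x\<in>carrier (?M (i + 2)). g (\<theta> i x) = x) \<and>
      (\<forall>y\<in>carrier (?M i). \<theta> i (g y) = y)"
    using gr_isoD(3)[OF \<theta>] by (simp add: Bex_def)
  from choice[OF this] obtain \<theta>' where \<theta>': "\<theta>' i \<in> gr_iso (tws (?M i)) (?M (i + 2))"
    and \<theta>'\<theta>: "x \<in> carrier (?M (i + 2)) \<Longrightarrow> \<theta>' i (\<theta> i x) = x"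
    and \<theta>\<theta>': "y \<in> carrier (?M i) \<Longrightarrow> \<theta> i (\<theta>' i y) = y" for i x y by blast
  have \<theta>'c: "\<theta>' i x \<in> carrier (?M (i + 2))" if "x \<in> carrier (?M i)" for i x
    using gr_homD(2)[OF gr_isoD(1)[OF \<theta>'], of x] that by simp
  \<comment> \<open>The map \<open>?\<phi> 1\<close> starts at position 2 rather than at the twist
    of position 0, so the inverse of \<open>\<theta> 0\<close> is put in front of it.\<close>
  define T where "T = \<lparr>tF = ?M 1, tG = ?M 0, tpsi = ?\<phi> 0,
    ttau = compose (carrier (?M 0)) (?\<phi> 1) (\<theta>' 0)\<rparr>"
  have T: "is_tmf scale S f d T"
    unfolding is_tmf_def
  proof (intro conjI ballI)
    show "\<exists>r. graded_free S r (tF T) \<and> graded_free S r (tG T)" using r by (auto simp: T_def)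
    show "tpsi T \<in> gr_hom (tF T) (tG T)" using \<phi>[of 0] by (simp add: T_def)
    show "ttau T \<in> gr_hom (tws (tG T)) (tF T)"
      using gr_hom_compose[of "tws (?M 0)" "\<theta>' 0" "?M 2" "?\<phi> 1" "?M 1"] cl gr_isoD(1)[OF \<theta>'[of 0]] \<phi>[of 1]
      by (simp add: T_def)
  next
    fix x assume "x \<in> carrier (tG T)"
    then have x: "x \<in> carrier (?M 0)" by (simp add: T_def)
    then show "tpsi T (ttau T x) = act (tG T) x f"
      using \<theta>f[OF \<theta>'c[OF x]] \<theta>\<theta>'[OF x] by (simp add: T_def compose_eq)
  next
    fix x assume "x \<in> carrier (tF T)"
    then have x: "x \<in> carrier (?M 1)" by (simp add: T_def)
    \<comment> \<open>Pulling x back to position 3 makes naturality applicable, and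
      \<open>\<theta> 1\<close> then reads the product of the maps at 1 and 2 as multiplication by
      f.\<close>
    let ?y = "\<theta>' 1 x"
    have y: "?y \<in> carrier (?M 3)" using \<theta>'c[OF x] by simp
    have "?\<phi> 0 x = \<theta> 0 (?\<phi> 2 ?y)" using natural[of ?y 0] y \<theta>\<theta>'[OF x] by simp
    then have "\<theta>' 0 (?\<phi> 0 x) = ?\<phi> 2 ?y" using \<theta>'\<theta>[of "?\<phi> 2 ?y" 0] \<phi>c[of ?y 2] y by simp
    then show "ttau T (tpsi T x) = act (tF T) x f"
      using \<phi>c[of x 0] x \<theta>f[of ?y 1] y \<theta>\<theta>'[OF x] by (simp add: T_def compose_eq)
  qed
  have "inj_on (\<theta> i) (carrier (?M (i + 2)))" for i
    using gr_isoD(2)[OF \<theta>] by (simp add: bij_betw_def)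
  \<comment> \<open>\<open>\<eta> i\<close> composes the \<open>\<theta>\<close>, or their inverses
    when i is negative, until position 0 or 1 is reached, according to parity.\<close>
  from two_step_recursion[of \<theta> "\<lambda>i. carrier (?M i)", OF this]
  obtain \<eta> where ext: "\<And>i. \<eta> i \<in> extensional (carrier (?M i))"
    and \<eta>0: "\<eta> 0 = (\<lambda>x\<in>carrier (?M 0). x)" and \<eta>1: "\<eta> 1 = (\<lambda>x\<in>carrier (?M 1). x)"
    and \<eta>2: "\<And>i x. x \<in> carrier (?M (i + 2)) \<Longrightarrow> \<eta> (i + 2) x = \<eta> i (\<theta> i x)"
    using \<theta>c by blast
  let ?N = "nmod (unroll T)" and ?\<psi> = "nmap (unroll T)"
  have clN: "closed_module (?N i)" for i by (rule is_nmfD(3)[OF is_nmf_unroll[OF T]])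
  have iso: "\<eta> i \<in> gr_iso (?M i) (?N i)" for i
  proof (rule int_shift_2_induct[of "\<lambda>i. \<eta> i \<in> gr_iso (?M i) (?N i)"])
    show "\<eta> 0 \<in> gr_iso (?M 0) (?N 0)" "\<eta> 1 \<in> gr_iso (?M 1) (?N 1)"
      using gr_iso_id[OF cl] by (simp_all add: \<eta>0 \<eta>1 unroll_def tcomponent_def T_def)
    fix i
    \<comment> \<open>Expressing each of \<open>\<eta> i\<close> and \<open>\<eta> (i + 2)\<close>
      through the other yields both directions of the induction step.\<close>
    have c1: "\<eta> (i + 2) = compose (carrier (?M (i + 2))) (\<eta> i) (\<theta> i)"
      by (rule extensionalityI[OF ext]) (simp_all add: \<eta>2 compose_eq)
    have c2: "\<eta> i = compose (carrier (?M i)) (\<eta> (i + 2)) (\<theta>' i)"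
      by (rule extensionalityI[OF ext]) (simp_all add: \<eta>2 compose_eq \<theta>'c \<theta>\<theta>')
    show "\<eta> (i + 2) \<in> gr_iso (?M (i + 2)) (?N (i + 2)) \<longleftrightarrow> \<eta> i \<in> gr_iso (?M i) (?N i)"
    proof
      assume "\<eta> (i + 2) \<in> gr_iso (?M (i + 2)) (?N (i + 2))"
      then have "compose (carrier (tws (?M i))) (\<eta> (i + 2)) (\<theta>' i) \<in> gr_iso (tws (?M i)) (tws (?N i))"
        using cl clN \<theta>' by (intro gr_iso_compose) (simp_all add: nmod_unroll_add_2)
      then show "\<eta> i \<in> gr_iso (?M i) (?N i)" using c2 by simp
    next
      assume "\<eta> i \<in> gr_iso (?M i) (?N i)"
      then show "\<eta> (i + 2) \<in> gr_iso (?M (i + 2)) (?N (i + 2))"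
        unfolding c1 nmod_unroll_add_2 using cl clN \<theta>
        by (intro gr_iso_compose[where N = "tws (?M i)"]) simp_all
    qed
  qed
  have comm: "\<forall>x\<in>carrier (?M (i + 1)). \<eta> i (?\<phi> i x) = ?\<psi> i (\<eta> (i + 1) x)" for i
  proof (rule int_shift_2_induct[of "\<lambda>i. \<forall>x\<in>carrier (?M (i + 1)). \<eta> i (?\<phi> i x) = ?\<psi> i (\<eta> (i + 1) x)"])
    show "\<forall>x\<in>carrier (?M (0 + 1)). \<eta> 0 (?\<phi> 0 x) = ?\<psi> 0 (\<eta> (0 + 1) x)"
      using \<phi>c[of _ 0] by (simp add: \<eta>0 \<eta>1 unroll_def T_def)
    \<comment> \<open>Here \<open>\<eta> 2\<close> is \<open>\<theta> 0\<close>, which cancels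
      against the inverse of \<open>\<theta> 0\<close> built into \<open>ttau T\<close>.\<close>
    show "\<forall>x\<in>carrier (?M (1 + 1)). \<eta> 1 (?\<phi> 1 x) = ?\<psi> 1 (\<eta> (1 + 1) x)"
      using \<phi>c[of _ 1] \<eta>2[of _ 0] \<theta>c[of _ 0] \<theta>'\<theta>[of _ 0]
      by (simp add: \<eta>0 \<eta>1 unroll_def T_def compose_eq)
    fix i
    have \<psi>2: "?\<psi> (i + 2) = ?\<psi> i" by (simp add: unroll_def)
    \<comment> \<open>By naturality the square at i + 2, evaluated at y, is the square at i,
      evaluated at \<open>\<theta> (i + 1) y\<close>. As \<open>\<theta> (i + 1)\<close> is onto,
      the two squares commute under the same condition.\<close>
    have step: "\<eta> (i + 2) (?\<phi> (i + 2) y) = \<eta> i (?\<phi> i (\<theta> (i + 1) y))"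
      "\<eta> (i + 3) y = \<eta> (i + 1) (\<theta> (i + 1) y)"
      if y: "y \<in> carrier (?M (i + 3))" for y
      using y \<phi>c[of y "i + 2"] natural[OF y] \<eta>2[of "?\<phi> (i + 2) y" i] \<eta>2[of y "i + 1"] by (simp_all add: int_index)
    show "(\<forall>x\<in>carrier (?M (i + 2 + 1)). \<eta> (i + 2) (?\<phi> (i + 2) x) = ?\<psi> (i + 2) (\<eta> (i + 2 + 1) x)) \<longleftrightarrow>
        (\<forall>x\<in>carrier (?M (i + 1)). \<eta> i (?\<phi> i x) = ?\<psi> i (\<eta> (i + 1) x))" (is "?L \<longleftrightarrow> ?R")
    proof
      assume ?L
      show ?R
      proof
        fix x assume x: "x \<in> carrier (?M (i + 1))"
        have y: "\<theta>' (i + 1) x \<in> carrier (?M (i + 3))" using \<theta>'c[OF x] by (simp add: int_index)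
        from \<open>?L\<close> y have "\<eta> (i + 2) (?\<phi> (i + 2) (\<theta>' (i + 1) x)) = ?\<psi> i (\<eta> (i + 3) (\<theta>' (i + 1) x))"
          by (simp only: int_index \<psi>2)
        then show "\<eta> i (?\<phi> i x) = ?\<psi> i (\<eta> (i + 1) x)"
          by (simp only: step[OF y] \<theta>\<theta>'[OF x])
      qed
    next
      assume ?R
      show ?L unfolding int_index \<psi>2
      proof
        fix y assume y: "y \<in> carrier (?M (i + 3))"
        then have "\<theta> (i + 1) y \<in> carrier (?M (i + 1))" using \<theta>c[of y "i + 1"] by (simp add: int_index)
        with \<open>?R\<close> show "\<eta> (i + 2) (?\<phi> (i + 2) y) = ?\<psi> i (\<eta> (i + 3) y)"
          by (simp only: step[OF y])
      qed
    qed
  qed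
  have "\<eta> \<in> nmf_hom X (unroll T)" using comm gr_isoD(1)[OF iso] by (simp add: nmf_hom_def)
  from is_iso_NMF[OF X is_nmf_unroll[OF T] this iso] T show ?thesis by blast
qed

end

theorem proposition4p8:
  fixes scale :: "'k::field \<Rightarrow> 'a::ring_1 \<Rightarrow> 'a"
    and S :: "nat \<Rightarrow> 'a set" and f :: 'a and d :: nat
  assumes "connected_graded_algebra scale S"
    and "locally_finite_algebra scale S"
    and "f \<in> S d" and "d \<ge> 1"
    and "regular_element f" and "normal_element f"
  shows "equivalent_categories
    (NMF S f d :: (('a, 'm) nmf, int \<Rightarrow> 'm \<Rightarrow> 'm) cat)
    (TMF scale S f d :: (('a, 'm) tmf, ('m \<Rightarrow> 'm) \<times> ('m \<Rightarrow> 'm)) cat)"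
proof -
  interpret normalized_element scale S f d
    using assms by unfold_locales (auto simp: connected_graded_algebra_def)
  show ?thesis
  proof (rule equivalent_categories_if_fully_faithful_ess_surj[OF is_category_NMF is_category_TMF is_functor_unroll])
    fix T U :: "('a, 'm) tmf"
    assume "T \<in> Obj (TMF scale S f d)" "U \<in> Obj (TMF scale S f d)"
    then show "bij_betw unroll_hom (Hom (TMF scale S f d) T U) (Hom (NMF S f d) (unroll T) (unroll U))"
      using bij_betw_unroll_hom by (simp add: TMF_def NMF_def)
  next
    fix X :: "('a, 'm) nmf"
    assume "X \<in> Obj (NMF S f d)"
    then show "\<exists>T\<in>Obj (TMF scale S f d). \<exists>\<mu>. is_iso (NMF S f d) X (unroll T) \<mu>"
      using unroll_essentially_surjective[of X] by (auto simp: TMF_def NMF_def)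
  qed
qed

end
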